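(* Let $G$ be a finite simple graph with $m$ edges that has no isolated edge. Then $G$ has a weak edge-locating-dominating set of size at most $\frac{m}{2}$.
   Context: An isolated edge of $G$ is an edge both of whose ends have degree $1$ (i.e. a connected component isomorphic to $K_2$). For an edge $e$ of $G$, $N(e)$ denotes the set of edges of $G$ different from $e$ that share an end with $e$, and $N[e]=N(e)\cup\{e\}$. Two distinct edges $e,f$ are edge-twins if $N(e)=N(f)$ (open edge-twins) or $N[e]=N[f]$ (closed edge-twins). A set $D\subseteq E(G)$ is an edge-dominating set if every edge in $E(G)\setminus D$ shares an end with some edge of $D$. A weak edge-locating-dominating set of $G$ is an edge-dominating set $D$ such that for every pair of distinct edges $e,f\in E(G)\setminus D$ that are not edge-twins, $N(e)\cap D\neq N(f)\cap D$. *)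

theory Defs
  imports Complex_Main "HOL-Library.Ramsey"
begin

(* nsets V 2 is the set of all 2-element subsets of V: edges are unordered
   pairs of distinct vertices, so there are no loops or parallel edges. *)
definition finite_simple_graph :: "'a set \<Rightarrow> 'a set set \<Rightarrow> bool" where
  "finite_simple_graph V E \<longleftrightarrow> finite V \<and> E \<subseteq> nsets V 2"

definition degree :: "'a set set \<Rightarrow> 'a \<Rightarrow> nat" where
  "degree E v = card {e \<in> E. v \<in> e}"

definition isolated_edge :: "'a set set \<Rightarrow> 'a set \<Rightarrow> bool" where
  "isolated_edge E e \<longleftrightarrow> e \<in> E \<and> (\<forall>v\<in>e. degree E v = 1)"

definition share_end :: "'a set \<Rightarrow> 'a set \<Rightarrow> bool" where
  "share_end e f \<longleftrightarrow> e \<inter> f \<noteq> {}"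

definition open_edge_nbhd :: "'a set set \<Rightarrow> 'a set \<Rightarrow> 'a set set" where
  "open_edge_nbhd E e = {f \<in> E. f \<noteq> e \<and> share_end e f}"

definition closed_edge_nbhd :: "'a set set \<Rightarrow> 'a set \<Rightarrow> 'a set set" where
  "closed_edge_nbhd E e = insert e (open_edge_nbhd E e)"

definition edge_twins :: "'a set set \<Rightarrow> 'a set \<Rightarrow> 'a set \<Rightarrow> bool" where
  "edge_twins E e f \<longleftrightarrow> e \<in> E \<and> f \<in> E \<and> e \<noteq> f \<and>
     (open_edge_nbhd E e = open_edge_nbhd E f \<or> closed_edge_nbhd E e = closed_edge_nbhd E f)"

definition edge_dominating_set :: "'a set set \<Rightarrow> 'a set set \<Rightarrow> bool" where
  "edge_dominating_set E D \<longleftrightarrow> D \<subseteq> E \<and> (\<forall>e \<in> E - D. \<exists>d\<in>D. share_end e d)"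

definition weak_edge_locating_dominating_set :: "'a set set \<Rightarrow> 'a set set \<Rightarrow> bool" where
  "weak_edge_locating_dominating_set E D \<longleftrightarrow> edge_dominating_set E D \<and>
     (\<forall>e \<in> E - D. \<forall>f \<in> E - D. e \<noteq> f \<longrightarrow> \<not> edge_twins E e f \<longrightarrow>
        open_edge_nbhd E e \<inter> D \<noteq> open_edge_nbhd E f \<inter> D)"

end

theory Submission
  imports Defs
begin

text \<open>
  Induction on the number of edges. At a vertex of degree two one removes two edges and adds one
  edge to the set obtained for the smaller graph; which edge works is decided by the edges of that
  set at the neighbouring vertices. The only pairs that need not be separated are two pendant edges
  at a common vertex, two edges of a triangle whose far ends have degree two, and the two end edges
  of a component that is a path with three edges.

  If no vertex has degree two, take an inclusion-minimal set D of edges covering all vertices of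
  degree at least three. It is a star forest, and every edge of D has a private end, which lies on at
  least two edges outside D. Counting these gives 2 |D| + p \<le> m, where p is the number of edges of D
  both of whose ends are private. If D is as large as possible (with a suitable tie-break), the only
  collisions left are between opposite edges of a 4-cycle whose other two edges are isolated edges of
  D. Joining such edges of D in disjoint pairs removes all of them and adds at most p/2 edges.
\<close>

section \<open>Pairs of edges that need not be separated\<close>

text \<open>\<open>good\<close> asks for more than the theorem: of all edge-twins only the patterns
  of \<open>exempt\<close> may collide. A short list matters because restoring deleted edges raises
  degrees and can turn a harmless pair into one that must be separated; with few patterns, the ways
  to spoil a pair can be met one by one. A pattern constrains the edges only at ends that its two
  edges do not share.

  Degree two must go first because of the count. A private end of degree at least three has one edge
  in D and two or more outside, and an outside edge has only two ends, so private ends are at most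
  as many as edges outside D. A private end of degree two would supply just one outside edge and
  spoil the factor 1/2.

  Maximality of D acts through exchanges: the configurations to be excluded would let k edges of D
  be traded for k + 1. Two of them, both around a triangle, may allow only an even trade; the
  tie-break is there for these.\<close>

definition simple_graph :: "'a set set \<Rightarrow> bool" where
  "simple_graph E \<longleftrightarrow> finite E \<and> (\<forall>e\<in>E. card e = 2)"

definition inc :: "'a set set \<Rightarrow> 'a \<Rightarrow> 'a set set" where
  "inc D v = {d \<in> D. v \<in> d}"

text \<open>For an edge outside \<open>D\<close> this is its open neighbourhood within
  \<open>D\<close>. Not excluding \<open>e\<close> itself makes the set a plain union over the two
  ends (\<open>nb_pair\<close>).\<close>

definition nb :: "'a set set \<Rightarrow> 'a set \<Rightarrow> 'a set set" where
  "nb D e = {d \<in> D. d \<inter> e \<noteq> {}}"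

definition no_isolated :: "'a set set \<Rightarrow> bool" where
  "no_isolated E \<longleftrightarrow> (\<forall>e\<in>E. \<exists>f\<in>E. f \<noteq> e \<and> f \<inter> e \<noteq> {})"

definition leaf_twins :: "'a set set \<Rightarrow> 'a set \<Rightarrow> 'a set \<Rightarrow> bool" where
  "leaf_twins E e f \<longleftrightarrow> (\<exists>s a b. a \<noteq> b \<and> e = {s, a} \<and> f = {s, b} \<and>
     inc E a = {{s, a}} \<and> inc E b = {{s, b}})"

definition triangle_twins :: "'a set set \<Rightarrow> 'a set \<Rightarrow> 'a set \<Rightarrow> bool" where
  "triangle_twins E e f \<longleftrightarrow> (\<exists>s a b. a \<noteq> b \<and> e = {s, a} \<and> f = {s, b} \<and>
     inc E a = {{s, a}, {a, b}} \<and> inc E b = {{s, b}, {a, b}})"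

definition path_twins :: "'a set set \<Rightarrow> 'a set \<Rightarrow> 'a set \<Rightarrow> bool" where
  "path_twins E e f \<longleftrightarrow> (\<exists>a b c d. distinct [a, b, c, d] \<and> e = {a, b} \<and> f = {c, d} \<and>
     inc E a = {{a, b}} \<and> inc E b = {{a, b}, {b, c}} \<and>
     inc E c = {{b, c}, {c, d}} \<and> inc E d = {{c, d}})"

text \<open>In a simple graph the first two patterns are exactly the closed edge-twins; the third is
  only one kind of open edge-twins. Opposite edges of a component that is a 4-cycle, for instance,
  are open edge-twins but not exempt.\<close>

definition exempt :: "'a set set \<Rightarrow> 'a set \<Rightarrow> 'a set \<Rightarrow> bool" where
  "exempt E e f \<longleftrightarrow> leaf_twins E e f \<or> triangle_twins E e f \<or> path_twins E e f"

definition good :: "'a set set \<Rightarrow> 'a set set \<Rightarrow> bool" where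
  "good E D \<longleftrightarrow> D \<subseteq> E \<and> (\<forall>e\<in>E - D. nb D e \<noteq> {}) \<and>
     (\<forall>e\<in>E - D. \<forall>f\<in>E - D. e \<noteq> f \<longrightarrow> nb D e = nb D f \<longrightarrow> exempt E e f)"

lemma inc_insert: "inc (insert e D) v = (if v \<in> e then insert e (inc D v) else inc D v)"
  by (auto simp: inc_def)

lemma inc_Diff: "inc (A - B) v = inc A v - B"
  by (auto simp: inc_def)

lemma inc_Un: "inc (A \<union> B) v = inc A v \<union> inc B v"
  by (auto simp: inc_def)

lemma in_inc_iff: "d \<in> inc D v \<longleftrightarrow> d \<in> D \<and> v \<in> d"
  by (auto simp: inc_def)

lemma nb_pair: "nb D {u, v} = inc D u \<union> inc D v"
  by (auto simp: inc_def nb_def)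

lemma nb_Un: "nb (A \<union> B) e = nb A e \<union> nb B e"
  by (auto simp: nb_def)

lemma simple_graph_edgeE:
  assumes "simple_graph E" "e \<in> E"
  obtains x y where "x \<noteq> y" "e = {x, y}"
  using assms unfolding simple_graph_def card_2_iff by metis

lemma simple_graph_edge_at:
  assumes "simple_graph E" "e \<in> E" "v \<in> e"
  obtains y where "y \<noteq> v" "e = {v, y}"
  using assms simple_graph_edgeE[of E e] by (metis insert_commute insert_iff singletonD)

lemma simple_graph_edge_eq:
  assumes "simple_graph E" "e \<in> E" "u \<in> e" "v \<in> e" "u \<noteq> v"
  shows "e = {u, v}"
  using assms by (elim simple_graph_edgeE) auto

lemma simple_graph_no_loop: "simple_graph E \<Longrightarrow> {u, v} \<in> E \<Longrightarrow> u \<noteq> v"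
  unfolding simple_graph_def by fastforce

lemma simple_graph_subset: "simple_graph E \<Longrightarrow> D \<subseteq> E \<Longrightarrow> simple_graph D"
  unfolding simple_graph_def by (auto intro: finite_subset)

lemma exempt_cases [consumes 1, case_names leaf triangle path]:
  assumes "exempt E e f"
  obtains (leaf) s a b where "a \<noteq> b" "e = {s, a}" "f = {s, b}"
      "inc E a = {{s, a}}" "inc E b = {{s, b}}"
    | (triangle) s a b where "a \<noteq> b" "e = {s, a}" "f = {s, b}"
      "inc E a = {{s, a}, {a, b}}" "inc E b = {{s, b}, {a, b}}"
    | (path) a b c d where "distinct [a, b, c, d]" "e = {a, b}" "f = {c, d}"
      "inc E a = {{a, b}}" "inc E b = {{a, b}, {b, c}}"
      "inc E c = {{b, c}, {c, d}}" "inc E d = {{c, d}}"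
  using assms unfolding exempt_def leaf_twins_def triangle_twins_def path_twins_def
  by (elim disjE exE conjE) (assumption | rule that)+

lemma exempt_leafI:
  "a \<noteq> b \<Longrightarrow> e = {s, a} \<Longrightarrow> f = {s, b} \<Longrightarrow> inc E a = {{s, a}} \<Longrightarrow> inc E b = {{s, b}} \<Longrightarrow>
    exempt E e f"
  unfolding exempt_def leaf_twins_def by blast

lemma exempt_triangleI:
  "a \<noteq> b \<Longrightarrow> e = {s, a} \<Longrightarrow> f = {s, b} \<Longrightarrow> inc E a = {{s, a}, {a, b}} \<Longrightarrow>
    inc E b = {{s, b}, {a, b}} \<Longrightarrow> exempt E e f"
  unfolding exempt_def triangle_twins_def by blast

lemma exempt_pathI:
  assumes "distinct [a, b, c, d]" "e = {a, b}" "f = {c, d}"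
    "inc E a = {{a, b}}" "inc E b = {{a, b}, {b, c}}"
    "inc E c = {{b, c}, {c, d}}" "inc E d = {{c, d}}"
  shows "exempt E e f"
proof -
  have "path_twins E e f"
    unfolding path_twins_def
    by (rule exI[of _ a], rule exI[of _ b], rule exI[of _ c], rule exI[of _ d])
      (intro conjI assms)
  then show ?thesis by (simp add: exempt_def)
qed

lemma exempt_sym:
  assumes "exempt E e f" shows "exempt E f e"
  using assms
proof (cases rule: exempt_cases)
  case (leaf s a b)
  show ?thesis by (rule exempt_leafI[of b a _ s]) (use leaf in auto)
next
  case (triangle s a b)
  show ?thesis by (rule exempt_triangleI[of b a _ s]) (use triangle in \<open>auto simp: insert_commute\<close>)
next
  case (path a b c d)
  show ?thesis by (rule exempt_pathI[of d c b a]) (use path in \<open>auto simp: insert_commute\<close>)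
qed

text \<open>Each pattern prescribes the incident edges only at ends lying on exactly one of the two
  edges; a shared end may gain or lose edges freely.\<close>

lemma exempt_lift:
  assumes ex: "exempt E' e f"
    and same: "\<And>v. v \<in> e - f \<union> (f - e) \<Longrightarrow> inc E v = inc E' v"
    and "card e = 2" "card f = 2"
  shows "exempt E e f"
  using ex
proof (cases rule: exempt_cases)
  case (leaf s a b)
  then have "s \<noteq> a" "s \<noteq> b" using assms(3,4) by auto
  then have "inc E a = inc E' a" "inc E b = inc E' b" using leaf same by auto
  with leaf show ?thesis by (intro exempt_leafI[of a b _ s]) auto
next
  case (triangle s a b)
  then have "s \<noteq> a" "s \<noteq> b" using assms(3,4) by auto
  then have "inc E a = inc E' a" "inc E b = inc E' b" using triangle same by auto
  with triangle show ?thesis by (intro exempt_triangleI[of a b _ s]) auto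
next
  case (path a b c d)
  then have "inc E a = inc E' a" "inc E b = inc E' b" "inc E c = inc E' c" "inc E d = inc E' d"
    by (intro same; auto)+
  with path show ?thesis by (intro exempt_pathI[of a b c d]) simp_all
qed

text \<open>In all three patterns an unshared end has no neighbour outside the pair. One such
  neighbour therefore refutes exemption.\<close>

lemma exempt_nbrs:
  assumes "exempt E e f" "v \<in> e" "v \<notin> f" "g \<in> inc E v"
  shows "g \<subseteq> e \<union> f"
  using assms by (cases rule: exempt_cases) auto

text \<open>Since \<open>D'\<close> lies in \<open>E - F\<close> and \<open>H\<close> in
  \<open>F\<close>, equal traces on the union mean equal traces on both parts. A collision of two
  old edges is thus a collision in the smaller graph that \<open>H\<close> fails to break, and only
  collisions with a deleted edge outside \<open>H\<close> are new.\<close>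

lemma good_extend:
  assumes good: "good E' D'"
    and E: "E' = E - F" and "H \<subseteq> F" "F \<subseteq> E"
    and dom: "\<And>e. e \<in> F - H \<Longrightarrow> nb (D' \<union> H) e \<noteq> {}"
    and new: "\<And>e f. e \<in> F - H \<Longrightarrow> f \<in> E - (D' \<union> H) \<Longrightarrow> e \<noteq> f \<Longrightarrow>
      nb (D' \<union> H) e = nb (D' \<union> H) f \<Longrightarrow> exempt E e f"
    and old: "\<And>e f. e \<in> E' - D' \<Longrightarrow> f \<in> E' - D' \<Longrightarrow> nb D' e = nb D' f \<Longrightarrow> nb H e = nb H f \<Longrightarrow>
      exempt E' e f \<Longrightarrow> exempt E e f"
  shows "good E (D' \<union> H)"
proof -
  have D': "D' \<subseteq> E'" using good by (simp add: good_def)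
  have split: "nb D' e = nb (D' \<union> H) e \<inter> E'" "nb H e = nb (D' \<union> H) e \<inter> F" for e
    using D' E \<open>H \<subseteq> F\<close> by (auto simp: nb_def)
  have cases: "e \<in> F - H \<or> e \<in> E' - D'" if "e \<in> E - (D' \<union> H)" for e
    using that E by auto
  show ?thesis
    unfolding good_def
  proof (intro conjI ballI impI)
    show "D' \<union> H \<subseteq> E" using D' E assms(3,4) by auto
  next
    fix e assume "e \<in> E - (D' \<union> H)"
    then show "nb (D' \<union> H) e \<noteq> {}"
      using cases[of e] dom[of e] good unfolding good_def nb_Un by auto
  next
    fix e f assume e: "e \<in> E - (D' \<union> H)" and f: "f \<in> E - (D' \<union> H)"
      and "e \<noteq> f" and eq: "nb (D' \<union> H) e = nb (D' \<union> H) f"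
    show "exempt E e f"
    proof (cases "e \<in> F - H \<or> f \<in> F - H")
      case True
      then show ?thesis
        using new[of e f] new[of f e] e f \<open>e \<noteq> f\<close> eq exempt_sym by metis
    next
      case False
      then have ef: "e \<in> E' - D'" "f \<in> E' - D'" using cases e f by auto
      then have "exempt E' e f"
        using good split eq \<open>e \<noteq> f\<close> unfolding good_def by metis
      then show ?thesis using old[OF ef] split eq by metis
    qed
  qed
qed

section \<open>Reductions at vertices of degree two\<close>

lemma simple_graph_card: "simple_graph E \<Longrightarrow> e \<in> E \<Longrightarrow> card e = 2"
  by (simp add: simple_graph_def)

lemma good_nb: "good E D \<Longrightarrow> e \<in> E \<Longrightarrow> e \<notin> D \<Longrightarrow> nb D e \<noteq> {}"
  by (simp add: good_def)

lemma good_exempt: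
  "good E D \<Longrightarrow> e \<in> E \<Longrightarrow> e \<notin> D \<Longrightarrow> f \<in> E \<Longrightarrow> f \<notin> D \<Longrightarrow> e \<noteq> f \<Longrightarrow> nb D e = nb D f \<Longrightarrow>
    exempt E e f"
  by (simp add: good_def)

lemma good_subset: "good E D \<Longrightarrow> D \<subseteq> E"
  by (simp add: good_def)

lemma in_nb_iff: "d \<in> nb D e \<longleftrightarrow> d \<in> D \<and> d \<inter> e \<noteq> {}"
  by (simp add: nb_def)

lemma nb_eq_meets: "nb D e = nb D f \<Longrightarrow> d \<in> D \<Longrightarrow> d \<inter> e \<noteq> {} \<longleftrightarrow> d \<inter> f \<noteq> {}"
  using in_nb_iff[of d D e] in_nb_iff[of d D f] by simp

text \<open>The edge \<open>{u, s}\<close> sees nothing but \<open>{u, w}\<close>, whereas every old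
  edge outside \<open>D'\<close> still sees something in \<open>D'\<close>; so \<open>{u, s}\<close>
  collides with nothing. Among the ends of old edges only \<open>w\<close> changes degree, and
  \<open>{u, w}\<close> separates old edges that differ there.\<close>

lemma reduce_pendant_path:
  assumes gr: "simple_graph E" and u: "inc E u = {{u, w}, {u, s}}" and "w \<noteq> s" and s: "inc E s = {{u, s}}"
    and good: "good (E - {{u, w}, {u, s}}) D'"
  shows "good E (insert {u, w} D')"
proof -
  let ?F = "{{u, w}, {u, s}}" and ?H = "{{u, w}}"
  let ?E' = "E - ?F"
  have in_E: "{u, w} \<in> E" "{u, s} \<in> E" using u by (auto simp: inc_def)
  then have ne: "u \<noteq> w" "u \<noteq> s" using gr simple_graph_no_loop by metis+
  have off: "u \<notin> e" "s \<notin> e" if "e \<in> ?E'" for e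
    using that u s by (auto simp: inc_def)
  have D': "D' \<subseteq> ?E'" using good by (rule good_subset)
  have us: "nb (D' \<union> ?H) {u, s} = {{u, w}}"
    using D' off ne \<open>w \<noteq> s\<close> by (auto simp: nb_def)
  have "good E (D' \<union> ?H)"
  proof (rule good_extend[OF good refl])
    show "?H \<subseteq> ?F" "?F \<subseteq> E" using in_E by auto
  next
    fix e assume "e \<in> ?F - ?H"
    then show "nb (D' \<union> ?H) e \<noteq> {}" using us by auto
  next
    fix e f assume e: "e \<in> ?F - ?H" and f: "f \<in> E - (D' \<union> ?H)" "e \<noteq> f"
      and eq: "nb (D' \<union> ?H) e = nb (D' \<union> ?H) f"
    have "e = {u, s}" using e by auto
    then have "nb (D' \<union> ?H) f = {{u, w}}" using eq us by simp
    moreover have "f \<in> ?E' - D'" using f \<open>e = {u, s}\<close> by auto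
    then have "nb D' f \<noteq> {}" using good_nb[OF good, of f] by auto
    moreover have "{u, w} \<notin> nb D' f" using D' by (auto simp: nb_def)
    moreover have "nb D' f \<subseteq> nb (D' \<union> ?H) f" by (auto simp: nb_def)
    ultimately show "exempt E e f" by auto
  next
    fix e f assume e: "e \<in> ?E' - D'" and f: "f \<in> ?E' - D'"
      and H: "nb ?H e = nb ?H f" and ex: "exempt ?E' e f"
    have "w \<in> e \<longleftrightarrow> w \<in> f"
      using nb_eq_meets[OF H, of "{u, w}"] off(1)[of e] off(1)[of f] e f by auto
    then have "v \<noteq> u \<and> v \<noteq> s \<and> v \<noteq> w" if "v \<in> e - f \<union> (f - e)" for v
      using off[of e] off[of f] e f that by auto
    then have "inc E v = inc ?E' v" if "v \<in> e - f \<union> (f - e)" for v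
      using that by (auto simp: inc_def)
    then show "exempt E e f"
      using exempt_lift[OF ex] simple_graph_card[OF gr] e f by auto
  qed
  then show ?thesis by simp
qed

text \<open>\<open>F\<close> is a component all of whose edges meet \<open>h\<close>, and its other
  edges are pairwise exempt; \<open>h\<close> alone then dominates it and separates it from the
  rest.\<close>

lemma reduce_component:
  assumes gr: "simple_graph E" and good: "good (E - F) D'" and "h \<in> F" "F \<subseteq> E"
    and sep: "\<And>e f. e \<in> F \<Longrightarrow> f \<in> E - F \<Longrightarrow> e \<inter> f = {}"
    and dom: "\<And>e. e \<in> F \<Longrightarrow> h \<inter> e \<noteq> {}"
    and ex: "\<And>e f. e \<in> F - {h} \<Longrightarrow> f \<in> F - {h} \<Longrightarrow> e \<noteq> f \<Longrightarrow> exempt E e f"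
  shows "good E (insert h D')"
proof -
  have D': "D' \<subseteq> E - F" using good by (rule good_subset)
  have "good E (D' \<union> {h})"
  proof (rule good_extend[OF good refl])
    show "{h} \<subseteq> F" "F \<subseteq> E" using assms by auto
  next
    fix e assume "e \<in> F - {h}"
    then show "nb (D' \<union> {h}) e \<noteq> {}" using dom by (auto simp: nb_def)
  next
    fix e f assume e: "e \<in> F - {h}" and f: "f \<in> E - (D' \<union> {h})" "e \<noteq> f"
      and eq: "nb (D' \<union> {h}) e = nb (D' \<union> {h}) f"
    have "h \<inter> f \<noteq> {}" using nb_eq_meets[OF eq, of h] dom[of e] e by simp
    then have "f \<in> F - {h}" using sep[OF \<open>h \<in> F\<close>] f by auto
    then show "exempt E e f" using ex e \<open>e \<noteq> f\<close> by blast
  next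
    fix e f assume e: "e \<in> E - F - D'" and f: "f \<in> E - F - D'" and exEF: "exempt (E - F) e f"
    have "inc E v = inc (E - F) v" if "v \<in> e - f \<union> (f - e)" for v
      using that e f sep by (fastforce simp: inc_def)
    then show "exempt E e f"
      using exempt_lift[OF exEF] simple_graph_card[OF gr] e f by auto
  qed
  then show ?thesis by simp
qed

text \<open>An old edge can collide with \<open>{w, v}\<close> only if it also sees
  \<open>{w, u}\<close>, that is, if it contains \<open>u\<close>; \<open>sep\<close> excludes
  exactly this. Old edges change their surroundings only at \<open>u\<close> and \<open>v\<close>,
  and the added edge separates those differing at \<open>u\<close>, so \<open>twins\<close> concerns
  only exempt pairs that differ at \<open>v\<close>.\<close>

lemma reduce_deg2:
  assumes gr: "simple_graph E" and w: "inc E w = {{w, u}, {w, v}}" and "u \<noteq> v" and E': "E' = E - {{w, u}, {w, v}}"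
    and good: "good E' D'"
    and sep: "\<And>b. {u, b} \<in> E' \<Longrightarrow> {u, b} \<notin> D' \<Longrightarrow> inc D' u \<union> inc D' b \<noteq> inc D' v"
    and twins: "\<And>e f. e \<in> E' \<Longrightarrow> e \<notin> D' \<Longrightarrow> f \<in> E' \<Longrightarrow> f \<notin> D' \<Longrightarrow>
      nb D' e = nb D' f \<Longrightarrow> exempt E' e f \<Longrightarrow> u \<in> e \<longleftrightarrow> u \<in> f \<Longrightarrow>
      v \<in> e \<Longrightarrow> v \<notin> f \<Longrightarrow> False"
  shows "good E (insert {w, u} D')"
proof -
  let ?F = "{{w, u}, {w, v}}" and ?H = "{{w, u}}"
  have in_E: "{w, u} \<in> E" "{w, v} \<in> E" using w by (auto simp: inc_def)
  then have ne: "w \<noteq> u" "w \<noteq> v" using gr simple_graph_no_loop by metis+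
  have off: "w \<notin> e" if "e \<in> E'" for e
    using that w E' by (auto simp: inc_def)
  have D': "D' \<subseteq> E'" using good by (rule good_subset)
  have H: "{w, u} \<in> nb (D' \<union> ?H) e \<longleftrightarrow> u \<in> e" if "e \<in> E'" for e
    using off[OF that] by (auto simp: nb_def)
  have nbD': "nb D' e = nb (D' \<union> ?H) e - ?H" for e
    using D' E' by (auto simp: nb_def)
  have wv: "nb D' {w, v} = inc D' v"
    using D' off by (auto simp: nb_def inc_def)
  have "good E (D' \<union> ?H)"
  proof (rule good_extend[OF good E'])
    show "?H \<subseteq> ?F" "?F \<subseteq> E" using in_E by auto
  next
    fix e assume "e \<in> ?F - ?H"
    then show "nb (D' \<union> ?H) e \<noteq> {}" by (auto simp: nb_def)
  next
    fix e f assume e: "e \<in> ?F - ?H" and f: "f \<in> E - (D' \<union> ?H)" "e \<noteq> f"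
      and eq: "nb (D' \<union> ?H) e = nb (D' \<union> ?H) f"
    have e': "e = {w, v}" using e by auto
    then have f': "f \<in> E'" "f \<notin> D'" using f E' by auto
    have "{w, u} \<in> nb (D' \<union> ?H) e" unfolding e' by (auto simp: nb_def)
    then have "u \<in> f" unfolding eq H[OF f'(1)] .
    moreover have "f \<in> E" using f by simp
    ultimately obtain b where b: "f = {u, b}" using simple_graph_edge_at[OF gr] by metis
    have "nb D' f = nb D' e" using eq nbD' by metis
    then have "inc D' u \<union> inc D' b = inc D' v" unfolding b e' wv by (simp add: nb_pair)
    then show "exempt E e f" using sep[of b] f' b by blast
  next
    fix e f assume e: "e \<in> E' - D'" and f: "f \<in> E' - D'"
      and eq: "nb D' e = nb D' f" and eqH: "nb ?H e = nb ?H f" and ex: "exempt E' e f"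
    have u: "u \<in> e \<longleftrightarrow> u \<in> f"
      using nb_eq_meets[OF eqH, of "{w, u}"] off[of e] off[of f] e f by auto
    have v: "v \<in> e \<longleftrightarrow> v \<in> f"
      using twins[of e f] twins[of f e] e f eq ex exempt_sym[OF ex] u by auto
    have "x \<noteq> u \<and> x \<noteq> v \<and> x \<noteq> w" if "x \<in> e - f \<union> (f - e)" for x
      using off[of e] off[of f] e f that u v by auto
    then have "inc E x = inc E' x" if "x \<in> e - f \<union> (f - e)" for x
      using that E' by (auto simp: inc_def)
    then show "exempt E e f"
      using exempt_lift[OF ex] simple_graph_card[OF gr] e f E' by auto
  qed
  then show ?thesis by simp
qed

definition pendant_path_free :: "'a set set \<Rightarrow> bool" where
  "pendant_path_free E \<longleftrightarrow>
    (\<forall>u w s. w \<noteq> s \<longrightarrow> inc E u = {{u, w}, {u, s}} \<longrightarrow> inc E s \<noteq> {{u, s}})"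

definition deg2_triangle_free :: "'a set set \<Rightarrow> bool" where
  "deg2_triangle_free E \<longleftrightarrow> (\<forall>w u v. u \<noteq> v \<longrightarrow> inc E w = {{w, u}, {w, v}} \<longrightarrow> {u, v} \<notin> E)"

lemma pendant_path_freeD:
  "pendant_path_free E \<Longrightarrow> inc E u = {{u, w}, {u, s}} \<Longrightarrow> w \<noteq> s \<Longrightarrow> inc E s = {{u, s}} \<Longrightarrow> False"
  unfolding pendant_path_free_def by blast

lemma deg2_triangle_freeD:
  "deg2_triangle_free E \<Longrightarrow> inc E w = {{w, u}, {w, v}} \<Longrightarrow> u \<noteq> v \<Longrightarrow> {u, v} \<in> E \<Longrightarrow> False"
  unfolding deg2_triangle_free_def by blast

text \<open>Restoring \<open>{w, v}\<close> spoils the pair at \<open>v\<close> only, so the pattern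
  persists at the other unshared ends. In a triangle pattern the second leaf would be a degree-two
  vertex on a triangle, in a path pattern the half avoiding \<open>v\<close> would be a pendant
  path. What remains is two pendant edges at \<open>t\<close>, one of them prolonged through
  \<open>v\<close> to \<open>w\<close>.\<close>

lemma deg2_twins:
  assumes gr: "simple_graph E" and w: "inc E w = {{w, u}, {w, v}}" and "u \<noteq> v" and E': "E' = E - {{w, u}, {w, v}}"
    and P: "pendant_path_free E" and T: "deg2_triangle_free E"
    and e: "e \<in> E'" and f: "f \<in> E'"
    and ex: "exempt E' e f" and u: "u \<in> e \<longleftrightarrow> u \<in> f" and v: "v \<in> e" "v \<notin> f"
  shows "\<exists>t z. e = {t, v} \<and> f = {t, z} \<and> inc E v = {{t, v}, {w, v}} \<and> inc E z = {{t, z}} \<and> z \<noteq> v"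
proof -
  have in_E: "{w, u} \<in> E" "{w, v} \<in> E" using w by (auto simp: inc_def)
  then have ne: "w \<noteq> u" "w \<noteq> v" using gr simple_graph_no_loop by metis+
  have off: "w \<notin> e" if "e \<in> E'" for e
    using that w E' by (auto simp: inc_def)
  have inc_v: "inc E v = insert {w, v} (inc E' v)"
    using in_E ne \<open>u \<noteq> v\<close> E' by (auto simp: inc_def)
  have inc_x: "inc E x = inc E' x" if "x \<in> e - f \<union> (f - e)" "x \<noteq> v" for x
    using that u off[OF e] off[OF f] E' by (auto simp: inc_def)
  have card: "card e = 2" "card f = 2" using e f simple_graph_card[OF gr] E' by auto
  from ex show ?thesis
  proof (cases rule: exempt_cases)
    case (leaf s a b)
    then have "a = v" "b \<noteq> v" "b \<in> f - e" using v card by auto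
    then have "inc E v = {{s, v}, {w, v}}" "inc E b = {{s, b}}"
      using inc_v inc_x[of b] leaf by auto
    then show ?thesis using leaf \<open>a = v\<close> by blast
  next
    case (triangle s a b)
    then have "a = v" "b \<noteq> v" "b \<in> f - e" using v card by auto
    then have "inc E b = {{b, s}, {b, v}}"
      using inc_x[of b] triangle by (auto simp: insert_commute)
    moreover have "e = {s, v}" using triangle(2) \<open>a = v\<close> by simp
    then have "{s, v} \<in> E" "s \<noteq> v" using e card E' by auto
    ultimately show ?thesis using deg2_triangle_freeD[OF T, of b s v] by simp
  next
    case (path a b c d)
    have "inc E c = {{c, b}, {c, d}}" "inc E d = {{c, d}}"
      using inc_x[of c] inc_x[of d] path v by (auto simp: insert_commute)
    moreover have "b \<noteq> d" using path by auto
    ultimately show ?thesis using pendant_path_freeD[OF P, of c b d] by simp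
  qed
qed

section \<open>The cost of one inductive step, and leaves attached to vertices of degree two\<close>

definition half_bound :: "'a set set \<Rightarrow> bool" where
  "half_bound E \<longleftrightarrow> (\<exists>D. good E D \<and> 2 * card D \<le> card E)"

lemma half_extend:
  assumes "simple_graph E" "F \<subseteq> E" "2 \<le> card F" "2 * card D' \<le> card (E - F)"
    and "good E D" "card D \<le> card D' + 1"
  shows "half_bound E"
proof -
  have "finite E" using assms by (simp add: simple_graph_def)
  then have "card E = card (E - F) + card F"
    using \<open>F \<subseteq> E\<close> by (metis card_Diff_subset card_mono diff_add finite_subset)
  then show ?thesis using assms unfolding half_bound_def by (intro exI[of _ D]) simp
qed

lemma not_no_isolatedE:
  assumes "\<not> no_isolated E'" 
  obtains e where "e \<in> E'" "\<forall>f\<in>E'. f \<noteq> e \<longrightarrow> f \<inter> e = {}"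
  using assms unfolding no_isolated_def by blast

lemma no_isolated_component:
  assumes "no_isolated E" and "\<And>e f. e \<in> F \<Longrightarrow> f \<in> E - F \<Longrightarrow> e \<inter> f = {}"
  shows "no_isolated (E - F)"
  using assms unfolding no_isolated_def by (metis DiffD1 DiffI)

lemma half_component:
  assumes gr: "simple_graph E" and IH: "\<And>E'. E' \<subset> E \<Longrightarrow> no_isolated E' \<Longrightarrow> half_bound E'"
    and iso: "no_isolated E" and "h \<in> F" "F \<subseteq> E" "2 \<le> card F"
    and sep: "\<And>e f. e \<in> F \<Longrightarrow> f \<in> E - F \<Longrightarrow> e \<inter> f = {}"
    and dom: "\<And>e. e \<in> F \<Longrightarrow> h \<inter> e \<noteq> {}"
    and ex: "\<And>e f. e \<in> F - {h} \<Longrightarrow> f \<in> F - {h} \<Longrightarrow> e \<noteq> f \<Longrightarrow> exempt E e f"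
  shows "half_bound E"
proof -
  have "half_bound (E - F)"
    using IH[of "E - F"] no_isolated_component[OF iso sep] \<open>h \<in> F\<close> \<open>F \<subseteq> E\<close> by auto
  then obtain D' where D': "good (E - F) D'" "2 * card D' \<le> card (E - F)"
    unfolding half_bound_def by blast
  have "good E (insert h D')"
    by (rule reduce_component[OF gr D'(1)]) (use assms in auto)
  moreover have "card (insert h D') \<le> card D' + 1"
    by (simp add: card_insert_le_m1 card_insert_if)
  ultimately show ?thesis using half_extend[OF gr] D' assms by metis
qed

lemma card_insert_le_Suc: "card (insert x A) \<le> card A + 1"
  by (cases "finite A") (auto simp: card_insert_if)

lemma incD: "inc E v = X \<Longrightarrow> f \<in> E \<Longrightarrow> v \<in> f \<Longrightarrow> f \<in> X"
  by (auto simp: inc_def)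

lemma half_pendant_path:
  assumes gr: "simple_graph E" and iso: "no_isolated E"
    and IH: "\<And>E'. E' \<subset> E \<Longrightarrow> no_isolated E' \<Longrightarrow> half_bound E'"
    and P: "\<not> pendant_path_free E"
  shows "half_bound E"
proof -
  obtain u w s where "w \<noteq> s" and u: "inc E u = {{u, w}, {u, s}}" and s: "inc E s = {{u, s}}"
    using P unfolding pendant_path_free_def by blast
  let ?F = "{{u, w}, {u, s}}"
  let ?E' = "E - ?F"
  have in_E: "{u, w} \<in> E" "{u, s} \<in> E" using u by (auto simp: inc_def)
  then have ne: "u \<noteq> w" "u \<noteq> s" using gr simple_graph_no_loop by metis+
  have off: "u \<notin> e" "s \<notin> e" if "e \<in> ?E'" for e
    using that u s by (auto simp: inc_def)
  show ?thesis
  proof (cases "no_isolated ?E'")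
    case True
    then have "half_bound ?E'" using IH[of ?E'] in_E by auto
    then obtain D' where D': "good ?E' D'" "2 * card D' \<le> card ?E'"
      unfolding half_bound_def by blast
    have "card ?F = 2" using ne \<open>w \<noteq> s\<close> by (simp add: doubleton_eq_iff)
    then show ?thesis
      using half_extend[OF gr _ _ D'(2) reduce_pendant_path[OF gr u \<open>w \<noteq> s\<close> s D'(1)]]
        in_E card_insert_le_Suc[of _ D'] by simp
  next
    case False
    \<comment> \<open>An edge isolated in \<open>?E'\<close> was adjacent to a deleted edge, and it
      can touch one only at \<open>w\<close>. The component is then the path s, u, w, b, for which
      the middle edge suffices.\<close>
    then obtain e where e: "e \<in> ?E'" "\<forall>f\<in>?E'. f \<noteq> e \<longrightarrow> f \<inter> e = {}"
      by (rule not_no_isolatedE)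
    obtain f where f: "f \<in> E" "f \<noteq> e" "f \<inter> e \<noteq> {}"
      using iso e(1) unfolding no_isolated_def by blast
    then have "f \<in> ?F" using e(2) by blast
    then have "w \<in> e" using f off[OF e(1)] by auto
    moreover have "e \<in> E" using e by simp
    ultimately obtain b where b: "e = {w, b}" "b \<noteq> w" using simple_graph_edge_at[OF gr] by metis
    have bus: "b \<noteq> u" "b \<noteq> s" using off[OF e(1)] b by auto
    have w: "inc E w = {{u, w}, {w, b}}"
      using e(2) b in_E \<open>e \<in> E\<close> \<open>w \<noteq> s\<close> ne by (auto simp: inc_def)
    have b': "inc E b = {{w, b}}"
      using e(2) b \<open>e \<in> E\<close> bus by (auto simp: inc_def)
    let ?G = "{{u, w}, {u, s}, {w, b}}"
    have G: "?G \<subseteq> E" using in_E \<open>e \<in> E\<close> b by simp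
    show ?thesis
    proof (rule half_component[OF gr IH iso, of "{u, w}" ?G])
      show "2 \<le> card ?G" using ne \<open>w \<noteq> s\<close> bus by (simp add: doubleton_eq_iff)
    next
      fix e f assume "e \<in> ?G" "f \<in> E - ?G"
      then have "u \<notin> f" "w \<notin> f" "s \<notin> f" "b \<notin> f"
        using incD[OF u, of f] incD[OF s, of f] incD[OF w, of f] incD[OF b', of f] by auto
      then show "e \<inter> f = {}" using \<open>e \<in> ?G\<close> by auto
    next
      have ex: "exempt E {u, s} {w, b}"
        by (rule exempt_pathI[of s u w b])
          (use ne \<open>w \<noteq> s\<close> bus b(2) u s w b' in \<open>auto simp: insert_commute\<close>)
      fix e f assume "e \<in> ?G - {{u, w}}" "f \<in> ?G - {{u, w}}" "e \<noteq> f"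
      then show "exempt E e f" using ex exempt_sym[OF ex] by auto
    qed (use G in auto)
  qed
qed

section \<open>Triangles through a vertex of degree two\<close>

text \<open>With \<open>w\<close> and \<open>v\<close> both of degree two, the edge opposite
  \<open>u\<close> is added: the only other edges that see it are \<open>{w, u}\<close> and
  \<open>{u, v}\<close>, and these are triangle twins, so they may collide.\<close>

lemma reduce_hanging_triangle:
  assumes gr: "simple_graph E" and w: "inc E w = {{w, u}, {w, v}}" and v: "inc E v = {{u, v}, {w, v}}"
    and "u \<noteq> v" and E': "E' = E - {{w, u}, {w, v}}"
    and good: "good E' D'" and Dv: "inc D' v = {}"
  shows "good E (insert {w, v} D')"
proof -
  let ?F = "{{w, u}, {w, v}}" and ?H = "{{w, v}}"
  have in_E: "{w, u} \<in> E" "{w, v} \<in> E" "{u, v} \<in> E" using w v by (auto simp: inc_def)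
  then have ne: "w \<noteq> u" "w \<noteq> v" using gr simple_graph_no_loop by metis+
  have off: "w \<notin> e" if "e \<in> E'" for e
    using that w E' by (auto simp: inc_def)
  have D': "D' \<subseteq> E'" using good by (rule good_subset)
  have E'v: "e = {u, v}" if "e \<in> E'" "v \<in> e" for e
    using that v E' by (auto simp: inc_def)
  have uv: "{u, v} \<in> E'" using in_E ne E' by (auto simp: doubleton_eq_iff)
  have ex: "exempt E {w, u} {u, v}"
    by (rule exempt_triangleI[of w v _ u]) (use ne w v in \<open>auto simp: insert_commute\<close>)
  have "good E (D' \<union> ?H)"
  proof (rule good_extend[OF good E'])
    show "?H \<subseteq> ?F" "?F \<subseteq> E" using in_E by auto
  next
    fix e assume "e \<in> ?F - ?H"
    then show "nb (D' \<union> ?H) e \<noteq> {}" by (auto simp: nb_def)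
  next
    fix e f assume e: "e \<in> ?F - ?H" and f: "f \<in> E - (D' \<union> ?H)" "e \<noteq> f"
      and eq: "nb (D' \<union> ?H) e = nb (D' \<union> ?H) f"
    have e': "e = {w, u}" using e by auto
    then have f': "f \<in> E'" using f E' by auto
    have "{w, v} \<inter> f \<noteq> {}" using nb_eq_meets[OF eq, of "{w, v}"] e' by simp
    then have "f = {u, v}" using E'v[OF f'] off[OF f'] by auto
    then show "exempt E e f" using ex e' by simp
  next
    fix e f assume e: "e \<in> E' - D'" and f: "f \<in> E' - D'"
      and eqH: "nb ?H e = nb ?H f" and ex: "exempt E' e f"
    have v: "v \<in> e \<longleftrightarrow> v \<in> f"
      using nb_eq_meets[OF eqH, of "{w, v}"] off[of e] off[of f] e f by auto
    \<comment> \<open>If \<open>u\<close> were unshared, the edge \<open>{u, v}\<close> would have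
      to stay inside the pair, so \<open>v\<close> lies on one of the two edges, hence on both; but
      \<open>{u, v}\<close> is the only old edge at \<open>v\<close>.\<close>
    have "u \<in> e \<longleftrightarrow> u \<in> f"
    proof (rule ccontr)
      assume *: "(u \<in> e) \<noteq> (u \<in> f)"
      have "{u, v} \<in> inc E' u" using uv by (simp add: inc_def)
      then have "{u, v} \<subseteq> e \<union> f"
        using exempt_nbrs[OF ex, of u] exempt_nbrs[OF exempt_sym[OF ex], of u] * by blast
      then have "v \<in> e" "v \<in> f" using v by auto
      then have "e = {u, v}" "f = {u, v}" using E'v e f by auto
      then show False using * by simp
    qed
    then have "x \<noteq> u \<and> x \<noteq> v \<and> x \<noteq> w" if "x \<in> e - f \<union> (f - e)" for x
      using off[of e] off[of f] e f that v by auto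
    then have "inc E x = inc E' x" if "x \<in> e - f \<union> (f - e)" for x
      using that E' by (auto simp: inc_def)
    then show "exempt E e f"
      using exempt_lift[OF ex] simple_graph_card[OF gr] e f E' by auto
  qed
  then show ?thesis by simp
qed

lemma inc_pairI: "{u, v} \<in> E \<Longrightarrow> {u, v} \<in> inc E u" "{u, v} \<in> E \<Longrightarrow> {u, v} \<in> inc E v"
  by (auto simp: inc_def)

text \<open>Every edge of \<open>D\<close> at \<open>u\<close> is also at \<open>v\<close>, and only
  one edge contains both.\<close>

lemma inc_only:
  assumes "simple_graph D" "inc D u = inc D v" "{u, v} \<in> D"
  shows "inc D u = {{u, v}}"
proof
  have "u \<noteq> v" using assms simple_graph_no_loop by metis
  then show "inc D u \<subseteq> {{u, v}}"
    using assms simple_graph_edge_eq[OF assms(1)] unfolding inc_def by blast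
  show "{{u, v}} \<subseteq> inc D u" using assms by (auto simp: inc_def)
qed

text \<open>The case where neither edge at \<open>w\<close> can simply be added. In
  \<open>E'\<close> the edges \<open>{u, b}\<close> and \<open>{v, a}\<close> see only
  \<open>{u, v}\<close>, so they collide and must be exempt, which forces \<open>u\<close> and
  \<open>v\<close> to have degree two there. Trading \<open>{u, v}\<close> for these two edges then
  works: \<open>{w, u}\<close> sees the first, \<open>{w, v}\<close> the second,
  \<open>{u, v}\<close> both, and no further edge touches the triangle.\<close>

lemma reduce_triangle_swap:
  assumes gr: "simple_graph E" and w: "inc E w = {{w, u}, {w, v}}" and "u \<noteq> v"
    and E': "E' = E - {{w, u}, {w, v}}"
    and good: "good E' D'" and uv: "{u, v} \<in> D'"
    and Du: "inc D' u = {{u, v}}" and Dv: "inc D' v = {{u, v}}"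
    and ub: "{u, b} \<in> E'" "{u, b} \<notin> D'" and va: "{v, a} \<in> E'" "{v, a} \<notin> D'"
    and Da: "inc D' a = {}" and Db: "inc D' b = {}"
  shows "good E (insert {u, b} (insert {v, a} (D' - {{u, v}})))" (is "good E ?D")
proof -
  have D': "D' \<subseteq> E'" using good by (rule good_subset)
  have in_E: "{w, u} \<in> E" "{w, v} \<in> E" using w by (auto simp: inc_def)
  then have ne: "w \<noteq> u" "w \<noteq> v" using gr simple_graph_no_loop by metis+
  have off: "w \<notin> e" if "e \<in> E'" for e
    using incD[OF w, of e] that E' by auto
  have "b \<noteq> v" "a \<noteq> u" using ub va uv by (auto simp: insert_commute)
  have "u \<noteq> b" "v \<noteq> a" using ub va E' simple_graph_no_loop[OF gr, of u b] simple_graph_no_loop[OF gr, of v a] by auto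
  have "a \<noteq> w" "b \<noteq> w" using off ub va by auto
  have ne2: "{u, b} \<noteq> {v, a}" "{u, b} \<noteq> {u, v}" "{v, a} \<noteq> {u, v}"
    using \<open>u \<noteq> v\<close> \<open>a \<noteq> u\<close> \<open>b \<noteq> v\<close> by (auto simp: doubleton_eq_iff)
  have "nb D' {u, b} = nb D' {v, a}" using Du Dv Da Db by (simp add: nb_pair)
  then have ex: "exempt E' {u, b} {v, a}"
    using good_exempt[OF good] ub va ne2 by metis
  have uvE: "{u, v} \<in> inc E' u" "{u, v} \<in> inc E' v"
    using uv D' by (auto simp: inc_def)
  \<comment> \<open>The leaf pattern would make \<open>u\<close> pendant in spite of
    \<open>{u, v}\<close>. The triangle pattern is the case a = b, the path pattern the case where
    \<open>a\<close> and \<open>b\<close> differ.\<close>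
  have inc': "inc E' u = {{u, b}, {u, v}} \<and> inc E' v = {{v, a}, {u, v}}"
    using ex
  proof (cases rule: exempt_cases)
    case (leaf s x y)
    have "u = s \<or> u = x" using leaf(2) by (auto simp: doubleton_eq_iff)
    moreover have "u \<noteq> s" using leaf(3) \<open>u \<noteq> v\<close> \<open>a \<noteq> u\<close> by (auto simp: doubleton_eq_iff)
    ultimately have "inc E' u = {{u, b}}" using leaf by simp
    then show ?thesis using uvE ne2 by auto
  next
    case (triangle s x y)
    have "u = s \<or> u = x" using triangle(2) by (auto simp: doubleton_eq_iff)
    moreover have "u \<noteq> s" using triangle(3) \<open>u \<noteq> v\<close> \<open>a \<noteq> u\<close> by (auto simp: doubleton_eq_iff)
    ultimately have "u = x" by blast
    then have "s = b" using triangle(2) \<open>u \<noteq> s\<close> by (auto simp: doubleton_eq_iff)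
    then have "y = v" using triangle(3) \<open>b \<noteq> v\<close> by (auto simp: doubleton_eq_iff)
    then show ?thesis
      using triangle(2-5) \<open>u = x\<close> by (simp add: insert_commute)
  next
    case (path x y z t)
    have "u \<noteq> x"
    proof
      assume "u = x"
      then have "inc E' u = {{u, b}}" using path(2,4) by simp
      then show False using uvE ne2 by auto
    qed
    then have u: "u = y" "b = x" using path(2) by (auto simp: doubleton_eq_iff)
    have "v \<noteq> t"
    proof
      assume "v = t"
      then have "inc E' v = {{v, a}}" using path(3,7) by simp
      then show False using uvE ne2 by auto
    qed
    then have v: "v = z" "a = t" using path(3) by (auto simp: doubleton_eq_iff)
    show ?thesis using path(5,6) u v by (simp add: insert_commute)
  qed
  have rest: "u \<notin> e \<and> v \<notin> e \<and> w \<notin> e" if "e \<in> E'" "e \<notin> D'" "e \<noteq> {u, b}" "e \<noteq> {v, a}" for e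
  proof -
    have "e \<noteq> {u, v}" using that uv by auto
    then show ?thesis
      using incD[OF conjunct1[OF inc'] that(1)] incD[OF conjunct2[OF inc'] that(1)] off[OF that(1)] that
      by auto
  qed
  have nb_rest: "nb D' e = nb ?D e \<inter> D'" if "e \<in> E'" "e \<notin> D'" "e \<noteq> {u, b}" "e \<noteq> {v, a}" for e
    using rest[OF that] ub va by (auto simp: nb_def)
  have nb_uv: "nb ?D {u, v} = {{u, b}, {v, a}}"
    using Du Dv by (auto simp: nb_def inc_def)
  have nb_w: "nb ?D {w, u} = {{u, b}}" "nb ?D {w, v} = {{v, a}}"
  proof -
    have "inc ?D w = {}" 
      using D' off \<open>a \<noteq> w\<close> \<open>b \<noteq> w\<close> ne by (auto simp: inc_def)
    moreover have "inc ?D u = {{u, b}}" "inc ?D v = {{v, a}}"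
      using Du Dv \<open>u \<noteq> v\<close> \<open>a \<noteq> u\<close> \<open>b \<noteq> v\<close> by (auto simp: inc_def)
    ultimately show "nb ?D {w, u} = {{u, b}}" "nb ?D {w, v} = {{v, a}}"
      by (simp_all add: nb_pair)
  qed
  let ?R = "{{u, v}, {w, u}, {w, v}}"
  have cases: "e \<in> ?R \<or> e \<in> E' \<and> e \<notin> D' \<and> e \<noteq> {u, b} \<and> e \<noteq> {v, a}" if "e \<in> E - ?D" for e
    using that E' by auto
  have new: "e = f" if e: "e \<in> ?R" and f: "f \<in> E - ?D" and eq: "nb ?D e = nb ?D f" for e f
  proof -
    have nb_e: "nb ?D e \<subseteq> {{u, b}, {v, a}}" using e nb_uv nb_w by auto
    from cases[OF f] show ?thesis
    proof
      assume "f \<in> ?R"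
      then show ?thesis using e eq nb_uv nb_w ne2(1) by auto
    next
      assume f': "f \<in> E' \<and> f \<notin> D' \<and> f \<noteq> {u, b} \<and> f \<noteq> {v, a}"
      then have "nb D' f = {}" using nb_rest[of f] nb_e eq ub va by auto
      then show ?thesis using good_nb[OF good, of f] f' by simp
    qed
  qed
  show ?thesis
    unfolding good_def
  proof (intro conjI ballI impI)
    show "?D \<subseteq> E" using D' E' ub va by auto
  next
    fix e assume "e \<in> E - ?D"
    from cases[OF this] show "nb ?D e \<noteq> {}"
    proof
      assume "e \<in> ?R"
      then show ?thesis using nb_uv nb_w by auto
    next
      assume e: "e \<in> E' \<and> e \<notin> D' \<and> e \<noteq> {u, b} \<and> e \<noteq> {v, a}"
      then show ?thesis using nb_rest[of e] good_nb[OF good, of e] by auto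
    qed
  next
    fix e f assume e: "e \<in> E - ?D" and f: "f \<in> E - ?D" and "e \<noteq> f" and eq: "nb ?D e = nb ?D f"
    have "e \<notin> ?R" using new[OF _ f eq] \<open>e \<noteq> f\<close> by blast
    moreover have "f \<notin> ?R" using new[OF _ e eq[symmetric]] \<open>e \<noteq> f\<close> by blast
    ultimately have e': "e \<in> E'" "e \<notin> D'" "e \<noteq> {u, b}" "e \<noteq> {v, a}"
      and f': "f \<in> E'" "f \<notin> D'" "f \<noteq> {u, b}" "f \<noteq> {v, a}"
      using cases[OF e] cases[OF f] by argo+
    have "nb D' e = nb D' f" using nb_rest[OF e'] nb_rest[OF f'] eq by simp
    then have ex: "exempt E' e f" using good_exempt[OF good] e' f' \<open>e \<noteq> f\<close> by metis
    have "x \<noteq> u \<and> x \<noteq> v \<and> x \<noteq> w" if "x \<in> e - f \<union> (f - e)" for x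
      using rest[OF e'] rest[OF f'] that by auto
    then have "inc E x = inc E' x" if "x \<in> e - f \<union> (f - e)" for x
      using that E' by (auto simp: inc_def)
    then show "exempt E e f"
      using exempt_lift[OF ex] simple_graph_card[OF gr] e f by auto
  qed
qed

lemma inc_common:
  assumes "simple_graph D" "d \<in> inc D u" "d \<in> inc D v" "u \<noteq> v"
  shows "d = {u, v}" "{u, v} \<in> D"
  using assms simple_graph_edge_eq[OF assms(1), of d u v] by (auto simp: inc_def)

text \<open>An edge of \<open>D'\<close> at \<open>u\<close> is not at \<open>v\<close>, since
  \<open>{u, v}\<close> is outside \<open>D'\<close>; so no old edge at \<open>u\<close> has the
  trace of \<open>{w, v}\<close>. A spoiled pair consists of \<open>{u, v}\<close> and another edge
  at \<open>u\<close>. Its leaf form contradicts \<open>hang\<close>, its triangle form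
  \<open>tri\<close>: there \<open>{v, z}\<close> must be in \<open>D'\<close>, as nothing else
  could dominate it.\<close>

lemma reduce_triangle_add:
  assumes gr: "simple_graph E" and w: "inc E w = {{w, u}, {w, v}}" and "u \<noteq> v"
    and E': "E' = E - {{w, u}, {w, v}}"
    and good: "good E' D'" and uv: "{u, v} \<in> E'" "{u, v} \<notin> D'"
    and Du: "inc D' u \<noteq> {}" and hang: "\<not> (inc D' v = {} \<and> inc E' v = {{u, v}})"
    and tri: "\<nexists>z. {u, z} \<in> E' \<and> {u, z} \<notin> D' \<and> {v, z} \<in> D' \<and>
      inc E' v = {{u, v}, {v, z}} \<and> inc E' z = {{u, z}, {v, z}}"
  shows "good E (insert {w, u} D')"
proof (rule reduce_deg2[OF gr w \<open>u \<noteq> v\<close> E' good])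
  have D': "D' \<subseteq> E'" using good by (rule good_subset)
  have "simple_graph D'" using simple_graph_subset[OF gr] D' E' by auto
  fix b assume "{u, b} \<in> E'" "{u, b} \<notin> D'"
  show "inc D' u \<union> inc D' b \<noteq> inc D' v"
    using inc_common[OF \<open>simple_graph D'\<close> _ _ \<open>u \<noteq> v\<close>] Du uv by blast
next
  have D': "D' \<subseteq> E'" using good by (rule good_subset)
  have "simple_graph E'" using simple_graph_subset[OF gr] E' by auto
  fix e f assume e: "e \<in> E'" "e \<notin> D'" and f: "f \<in> E'" "f \<notin> D'" and ex: "exempt E' e f"
    and u: "u \<in> e \<longleftrightarrow> u \<in> f" and v: "v \<in> e" "v \<notin> f"
  have "{u, v} \<subseteq> e \<union> f" by (rule exempt_nbrs[OF ex v inc_pairI(2)[OF uv(1)]])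
  then have u': "u \<in> e" "u \<in> f" using u by auto
  have e': "e = {u, v}" using simple_graph_edge_eq[OF \<open>simple_graph E'\<close> e(1)] u' v \<open>u \<noteq> v\<close> by blast
  from ex show False
  proof (cases rule: exempt_cases)
    case (leaf s x y)
    have "s = u" "x = v" using leaf(2,3) e' v \<open>u \<noteq> v\<close> by (auto simp: doubleton_eq_iff)
    then have "inc E' v = {{u, v}}" using leaf by simp
    moreover have "inc D' v \<subseteq> inc E' v - {{u, v}}" using D' uv by (auto simp: inc_def)
    ultimately show False using hang by simp
  next
    case (triangle s x y)
    have "s = u" "x = v" using triangle(2,3) e' v \<open>u \<noteq> v\<close> by (auto simp: doubleton_eq_iff)
    then have *: "f = {u, y}" "inc E' v = {{u, v}, {v, y}}" "inc E' y = {{u, y}, {v, y}}"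
      using triangle by auto
    then have "{v, y} \<notin> D'" using tri f by blast
    moreover have "inc D' v \<subseteq> inc E' v \<inter> D'" "inc D' y \<subseteq> inc E' y \<inter> D'"
      using D' by (auto simp: inc_def)
    ultimately have "nb D' {v, y} = {}" using * uv f by (auto simp: nb_pair)
    moreover have "{v, y} \<in> E'" using *(2) by (auto simp: inc_def)
    ultimately show False using good_nb[OF good] \<open>{v, y} \<notin> D'\<close> by blast
  next
    case (path a b c d)
    then show False using u' by auto
  qed
qed

text \<open>A pair spoiled at \<open>v\<close> would have to contain \<open>{u, v}\<close> itself,
  but this edge is in \<open>D'\<close> and needs no separation.\<close>

lemma reduce_triangle_edge:
  assumes gr: "simple_graph E" and w: "inc E w = {{w, u}, {w, v}}" and "u \<noteq> v"
    and E': "E' = E - {{w, u}, {w, v}}"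
    and good: "good E' D'" and uv: "{u, v} \<in> E'" "{u, v} \<in> D'"
    and sep: "\<And>b. {u, b} \<in> E' \<Longrightarrow> {u, b} \<notin> D' \<Longrightarrow> inc D' u \<union> inc D' b \<noteq> inc D' v"
  shows "good E (insert {w, u} D')"
proof (rule reduce_deg2[OF gr w \<open>u \<noteq> v\<close> E' good sep])
  have "simple_graph E'" using simple_graph_subset[OF gr] E' by auto
  fix e f assume e: "e \<in> E'" "e \<notin> D'" and ex: "exempt E' e f"
    and u: "u \<in> e \<longleftrightarrow> u \<in> f" and v: "v \<in> e" "v \<notin> f"
  have "{u, v} \<subseteq> e \<union> f" by (rule exempt_nbrs[OF ex v inc_pairI(2)[OF uv(1)]])
  then have u': "u \<in> e" using u by auto
  have "e = {u, v}" using simple_graph_edge_eq[OF \<open>simple_graph E'\<close> e(1)] u' v \<open>u \<noteq> v\<close> by blast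
  then show False using uv e by simp
qed

text \<open>The roles of \<open>u\<close> and \<open>v\<close> may be exchanged, so there are always
  two candidates to add. If \<open>{u, v}\<close> is in \<open>D'\<close> and both fail, the two
  collisions give inclusions both ways between the \<open>D'\<close>-edges at \<open>u\<close> and
  at \<open>v\<close>; these then consist of \<open>{u, v}\<close> alone, which is the setting of
  the swap. If \<open>{u, v}\<close> is not in \<open>D'\<close> and no hanging triangle occurs, the
  obstructions on the two sides cannot coexist.\<close>

lemma triangle_good:
  assumes gr: "simple_graph E" and w: "inc E w = {{w, u}, {w, v}}" and "u \<noteq> v"
    and E': "E' = E - {{w, u}, {w, v}}"
    and good: "good E' D'" and uv: "{u, v} \<in> E'"
  shows "\<exists>D. good E D \<and> card D \<le> card D' + 1"
proof -
  have D': "D' \<subseteq> E'" using good by (rule good_subset)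
  have "simple_graph E'" "simple_graph D'" using simple_graph_subset[OF gr] D' E' by auto
  have vu: "{v, u} \<in> E'" using uv by (simp add: insert_commute)
  have w2: "inc E w = {{w, v}, {w, u}}" and E'2: "E' = E - {{w, v}, {w, u}}"
    using w E' by (simp_all add: insert_commute)
  have insert: ?thesis if "good E (insert x D')" for x
    using that card_insert_le_Suc[of x D'] by auto
  show ?thesis
  proof (cases "{u, v} \<in> D'")
    case True
    then have vuD: "{v, u} \<in> D'" by (simp add: insert_commute)
    show ?thesis
    proof (cases "\<forall>b. {u, b} \<in> E' \<longrightarrow> {u, b} \<notin> D' \<longrightarrow> inc D' u \<union> inc D' b \<noteq> inc D' v")
      case True
      show ?thesis
        by (rule insert, rule reduce_triangle_edge[OF gr w \<open>u \<noteq> v\<close> E' good uv \<open>{u, v} \<in> D'\<close>])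
          (simp add: True)
    next
      case False
      then obtain b where b: "{u, b} \<in> E'" "{u, b} \<notin> D'" "inc D' u \<union> inc D' b = inc D' v"
        by blast
      show ?thesis
      proof (cases "\<forall>a. {v, a} \<in> E' \<longrightarrow> {v, a} \<notin> D' \<longrightarrow> inc D' v \<union> inc D' a \<noteq> inc D' u")
        case True
        show ?thesis
          by (rule insert, rule reduce_triangle_edge[OF gr w2 \<open>u \<noteq> v\<close>[symmetric] E'2 good vu vuD])
            (simp add: True)
      next
        case False
        then obtain a where a: "{v, a} \<in> E'" "{v, a} \<notin> D'" "inc D' v \<union> inc D' a = inc D' u"
          by blast
        have eq: "inc D' u = inc D' v" using a(3) b(3) by blast
        then have Du: "inc D' u = {{u, v}}" using inc_only[OF \<open>simple_graph D'\<close>] True by simp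
        then have Dv: "inc D' v = {{u, v}}" using eq by simp
        have "inc D' x = {}" if "x \<noteq> u" "x \<noteq> v" "inc D' x \<subseteq> {{u, v}}" for x
          using that by (auto simp: inc_def)
        moreover have "b \<noteq> u" "a \<noteq> v" using a b simple_graph_no_loop[OF \<open>simple_graph E'\<close>] by metis+
        moreover have "b \<noteq> v" "a \<noteq> u" using a b True by (auto simp: insert_commute)
        moreover have "inc D' b \<subseteq> {{u, v}}" "inc D' a \<subseteq> {{u, v}}" using a b Du Dv by auto
        ultimately have "inc D' b = {}" "inc D' a = {}" using a b by metis+
        then have "good E (insert {u, b} (insert {v, a} (D' - {{u, v}})))"
          using reduce_triangle_swap[OF gr w \<open>u \<noteq> v\<close> E' good True Du Dv b(1,2) a(1,2)] by simp
        moreover have "card (insert {u, b} (insert {v, a} (D' - {{u, v}}))) \<le> card D' + 1"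
        proof -
          have "finite D'" using \<open>simple_graph D'\<close> by (simp add: simple_graph_def)
          then have "card (D' - {{u, v}}) + 1 = card D'"
            using True by (metis Suc_eq_plus1 card_Suc_Diff1)
          then show ?thesis
            using card_insert_le_Suc[of "{v, a}" "D' - {{u, v}}"]
              card_insert_le_Suc[of "{u, b}" "insert {v, a} (D' - {{u, v}})"] by simp
        qed
        ultimately show ?thesis by blast
      qed
    qed
  next
    case False
    then have vuD: "{v, u} \<notin> D'" by (simp add: insert_commute)
    have in_E: "{w, u} \<in> E" "{w, v} \<in> E" using w by (auto simp: inc_def)
    have ne: "w \<noteq> u" "w \<noteq> v" using in_E gr simple_graph_no_loop by metis+
    have incE: "inc E u = insert {w, u} (inc E' u)" "inc E v = insert {w, v} (inc E' v)"
      using E' in_E \<open>u \<noteq> v\<close> ne by (auto simp: inc_def)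
    show ?thesis
    proof (cases "inc D' v = {} \<and> inc E' v = {{u, v}}")
      case True
      then have "inc E v = {{u, v}, {w, v}}" using incE by auto
      then show ?thesis
        using insert[OF reduce_hanging_triangle[OF gr w _ \<open>u \<noteq> v\<close> E' good]] True by simp
    next
      case hv: False
      show ?thesis
      proof (cases "inc D' u = {} \<and> inc E' u = {{v, u}}")
        case True
        then have "inc E u = {{v, u}, {w, u}}" using incE by auto
        then show ?thesis
          using insert[OF reduce_hanging_triangle[OF gr w2 _ \<open>u \<noteq> v\<close>[symmetric] E'2 good]] True
          by simp
      next
        case hu: False
        let ?T = "\<lambda>u v z. {u, z} \<in> E' \<and> {u, z} \<notin> D' \<and> {v, z} \<in> D' \<and>
          inc E' v = {{u, v}, {v, z}} \<and> inc E' z = {{u, z}, {v, z}}"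
        have addu: ?thesis if "inc D' u \<noteq> {}" "\<nexists>z. ?T u v z"
          by (rule insert[OF reduce_triangle_add[OF gr w \<open>u \<noteq> v\<close> E' good uv False that(1) hv that(2)]])
        have addv: ?thesis if "inc D' v \<noteq> {}" "\<nexists>z. ?T v u z"
          by (rule insert[OF reduce_triangle_add[OF gr w2 \<open>u \<noteq> v\<close>[symmetric] E'2 good vu vuD
                that(1) hu that(2)]])
        have one: "inc D' u \<noteq> {} \<or> inc D' v \<noteq> {}"
          using good_nb[OF good uv False] by (simp add: nb_pair)
        have T_inc: "inc D' y \<noteq> {}" if "?T x y z" for x y z
        proof -
          have "{y, z} \<in> D'" using that by argo
          then show ?thesis using inc_pairI(1) by fastforce
        qed
        \<comment> \<open>The second obstruction leaves only \<open>{v, u}\<close> and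
          \<open>{u, z'}\<close> at \<open>u\<close>, the latter in \<open>D'\<close>. As
          \<open>{u, z}\<close> is an edge outside \<open>D'\<close>, it must be
          \<open>{v, u}\<close>, and then \<open>{v, z}\<close> would be a loop.\<close>
        have no_T: False if A: "?T u v z" and B: "?T v u z'" for z z'
        proof -
          have A': "{u, z} \<in> E'" "{u, z} \<notin> D'" "{v, z} \<in> D'" using A by argo+
          have B': "{u, z'} \<in> D'" "inc E' u = {{v, u}, {u, z'}}" using B by argo+
          have "{u, z} \<in> {{v, u}, {u, z'}}" using incD[OF B'(2) A'(1)] by simp
          moreover have "{u, z} \<noteq> {u, z'}" using A'(2) B'(1) by metis
          ultimately have "{u, z} = {v, u}" by simp
          then have "z = v" using \<open>u \<noteq> v\<close> by (simp add: doubleton_eq_iff)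
          then show False using A'(3) simple_graph_no_loop[OF \<open>simple_graph D'\<close>] by metis
        qed
        show ?thesis
        proof (rule ccontr)
          assume no: "\<not> ?thesis"
          have u: "inc D' u = {} \<or> (\<exists>z. ?T u v z)" using addu no by argo
          have v: "inc D' v = {} \<or> (\<exists>z. ?T v u z)" using addv no by argo
          show False
          proof (cases "\<exists>z. ?T u v z")
            case True
            then obtain z where z: "?T u v z" ..
            have "\<exists>z. ?T v u z" using T_inc[OF z] v by argo
            then obtain z' where z': "?T v u z'" ..
            show False by (rule no_T[OF z z'])
          next
            case False
            then have "inc D' u = {}" using u by argo
            then have "\<exists>z. ?T v u z" using v one by argo
            then obtain z where z: "?T v u z" ..
            show False using T_inc[OF z] \<open>inc D' u = {}\<close> by argo
          qed
        qed
      qed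
    qed
  qed
qed

lemma half_triangle:
  assumes gr: "simple_graph E" and iso: "no_isolated E"
    and IH: "\<And>E'. E' \<subset> E \<Longrightarrow> no_isolated E' \<Longrightarrow> half_bound E'"
    and T: "\<not> deg2_triangle_free E"
  shows "half_bound E"
proof -
  obtain w u v where "u \<noteq> v" and w: "inc E w = {{w, u}, {w, v}}" and uvE: "{u, v} \<in> E"
    using T unfolding deg2_triangle_free_def by blast
  let ?F = "{{w, u}, {w, v}}"
  let ?E' = "E - ?F"
  have in_E: "{w, u} \<in> E" "{w, v} \<in> E" using w by (auto simp: inc_def)
  then have ne: "w \<noteq> u" "w \<noteq> v" using gr simple_graph_no_loop by metis+
  have off: "w \<notin> e" if "e \<in> ?E'" for e
    using incD[OF w, of e] that by auto
  have uv: "{u, v} \<in> ?E'" using uvE ne by (auto simp: doubleton_eq_iff)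
  show ?thesis
  proof (cases "no_isolated ?E'")
    case True
    then have "half_bound ?E'" using IH[of ?E'] in_E by auto
    then obtain D' where D': "good ?E' D'" "2 * card D' \<le> card ?E'"
      unfolding half_bound_def by blast
    obtain D where "good E D" "card D \<le> card D' + 1"
      using triangle_good[OF gr w \<open>u \<noteq> v\<close> refl D'(1) uv] by blast
    moreover have "card ?F = 2" using \<open>u \<noteq> v\<close> ne by (simp add: doubleton_eq_iff)
    ultimately show ?thesis using half_extend[OF gr _ _ D'(2)] in_E by simp
  next
    case False
    \<comment> \<open>An edge isolated in \<open>?E'\<close> contains \<open>u\<close> or
      \<open>v\<close>, because it was adjacent to a deleted edge. It therefore meets
      \<open>{u, v}\<close>, hence equals it, and the triangle is a whole component.\<close>
    then obtain e where e: "e \<in> ?E'" "\<forall>f\<in>?E'. f \<noteq> e \<longrightarrow> f \<inter> e = {}"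
      by (rule not_no_isolatedE)
    obtain f where f: "f \<in> E" "f \<noteq> e" "f \<inter> e \<noteq> {}"
      using iso e(1) unfolding no_isolated_def by blast
    then have "f \<in> ?F" using e(2) by blast
    then have "u \<in> e \<or> v \<in> e" using f off[OF e(1)] by auto
    then have e': "e = {u, v}" using bspec[OF e(2) uv] by auto
    have only: "g \<in> {{u, v}, {w, u}, {w, v}}" if "g \<in> E" "u \<in> g \<or> v \<in> g" for g
      using that e(2) e' by auto
    have u: "inc E u = {{u, v}, {w, u}}"
      using only in_E uvE ne \<open>u \<noteq> v\<close> by (auto simp: inc_def)
    have v: "inc E v = {{u, v}, {w, v}}"
      using only in_E uvE ne \<open>u \<noteq> v\<close> by (auto simp: inc_def)
    let ?G = "{{u, v}, {w, u}, {w, v}}"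
    show ?thesis
    proof (rule half_component[OF gr IH iso, of "{u, v}" ?G])
      show "?G \<subseteq> E" using in_E uvE by simp
      show "2 \<le> card ?G" using ne \<open>u \<noteq> v\<close> by (simp add: doubleton_eq_iff)
    next
      fix e f assume "e \<in> ?G" "f \<in> E - ?G"
      then have "u \<notin> f" "w \<notin> f" "v \<notin> f"
        using incD[OF u, of f] incD[OF w, of f] incD[OF v, of f] by auto
      then show "e \<inter> f = {}" using \<open>e \<in> ?G\<close> by auto
    next
      have ex: "exempt E {w, u} {w, v}"
        by (rule exempt_triangleI[of u v _ w]) (use \<open>u \<noteq> v\<close> u v in \<open>auto simp: insert_commute\<close>)
      fix e f assume "e \<in> ?G - {{u, v}}" "f \<in> ?G - {{u, v}}" "e \<noteq> f"
      then show "exempt E e f" using ex exempt_sym[OF ex] by auto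
    qed auto
  qed
qed

section \<open>Vertices of degree two that lie on no triangle\<close>

text \<open>A newly isolated edge \<open>{x, t}\<close> has \<open>x\<close> among \<open>u\<close>,
  \<open>v\<close> and differs from \<open>{u, v}\<close>. Restoring the two deleted edges leaves
  \<open>t\<close> pendant and gives \<open>x\<close> degree two, so a pendant path appears.\<close>

lemma no_isolated_deg2:
  assumes gr: "simple_graph E" and iso: "no_isolated E" and P: "pendant_path_free E"
    and w: "inc E w = {{w, u}, {w, v}}" and "u \<noteq> v" and uv: "{u, v} \<notin> E"
  shows "no_isolated (E - {{w, u}, {w, v}})"
proof (rule ccontr)
  let ?E' = "E - {{w, u}, {w, v}}"
  assume "\<not> no_isolated ?E'"
  then obtain e where e: "e \<in> ?E'" "\<forall>f\<in>?E'. f \<noteq> e \<longrightarrow> f \<inter> e = {}"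
    by (rule not_no_isolatedE)
  have in_E: "{w, u} \<in> E" "{w, v} \<in> E" using w by (auto simp: inc_def)
  have ne: "w \<noteq> u" "w \<noteq> v" using in_E gr simple_graph_no_loop by metis+
  have "w \<notin> e" using incD[OF w, of e] e by auto
  obtain f where f: "f \<in> E" "f \<noteq> e" "f \<inter> e \<noteq> {}"
    using iso e(1) unfolding no_isolated_def by blast
  then have "f \<in> {{w, u}, {w, v}}" using e(2) by blast
  then obtain x y where x: "x \<in> e" "x \<noteq> w" "{x, y} = {u, v}" "x \<noteq> y"
    using f \<open>w \<notin> e\<close> ne \<open>u \<noteq> v\<close> by auto
  have "e \<in> E" using e by simp
  then obtain t where t: "e = {x, t}" "t \<noteq> x" using simple_graph_edge_at[OF gr _ x(1)] by metis
  have "t \<noteq> y" using uv \<open>e \<in> E\<close> t x(3) by auto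
  have "t \<noteq> w" using \<open>w \<notin> e\<close> t by auto
  have "t \<noteq> u" "t \<noteq> v" using x(3) t(2) \<open>t \<noteq> y\<close> by (auto simp: doubleton_eq_iff)
  have only: "g = e" if "g \<in> E" "g \<noteq> {w, u}" "g \<noteq> {w, v}" "g \<inter> e \<noteq> {}" for g
    using that e(2) by blast
  have t_E: "{x, t} \<in> E" "{x, w} \<in> E"
    using \<open>e \<in> E\<close> t x(3) in_E by (auto simp: doubleton_eq_iff insert_commute)
  have "inc E x = {{x, w}, {x, t}}"
  proof
    show "{{x, w}, {x, t}} \<subseteq> inc E x" using t_E by (auto simp: inc_def)
    show "inc E x \<subseteq> {{x, w}, {x, t}}"
    proof
      fix g assume g: "g \<in> inc E x"
      then have "g \<in> E" "x \<in> g" by (auto simp: inc_def)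
      then show "g \<in> {{x, w}, {x, t}}"
        using only[of g] t x ne by (auto simp: insert_commute)
    qed
  qed
  moreover have "inc E t = {{x, t}}"
  proof
    show "{{x, t}} \<subseteq> inc E t" using t_E by (auto simp: inc_def)
    show "inc E t \<subseteq> {{x, t}}"
    proof
      fix g assume g: "g \<in> inc E t"
      then have "g \<in> E" "t \<in> g" by (auto simp: inc_def)
      then show "g \<in> {{x, t}}"
        using only[of g] t \<open>t \<noteq> u\<close> \<open>t \<noteq> v\<close> \<open>t \<noteq> w\<close> by auto
    qed
  qed
  ultimately show False using pendant_path_freeD[OF P, of x w t] \<open>t \<noteq> w\<close> by simp
qed

text \<open>The two deleted edges pay for any single addition to \<open>D'\<close>, so afterwards
  only the choice of the added edge matters.\<close>

lemma deg2_setup: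
  assumes gr: "simple_graph E" and iso: "no_isolated E" and P: "pendant_path_free E"
    and T: "deg2_triangle_free E" and IH: "\<And>E'. E' \<subset> E \<Longrightarrow> no_isolated E' \<Longrightarrow> half_bound E'"
    and w: "inc E w = {{w, u}, {w, v}}" and "u \<noteq> v"
  obtains D' where "good (E - {{w, u}, {w, v}}) D'"
    "\<And>x. good E (insert x D') \<Longrightarrow> half_bound E"
proof -
  let ?F = "{{w, u}, {w, v}}"
  have in_E: "{w, u} \<in> E" "{w, v} \<in> E" using w by (auto simp: inc_def)
  have ne: "w \<noteq> u" "w \<noteq> v" using in_E gr simple_graph_no_loop by metis+
  have "{u, v} \<notin> E" using deg2_triangle_freeD[OF T w \<open>u \<noteq> v\<close>] by blast
  then have "no_isolated (E - ?F)" using no_isolated_deg2[OF gr iso P w \<open>u \<noteq> v\<close>] by simp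
  then have "half_bound (E - ?F)" using IH[of "E - ?F"] in_E by auto
  then obtain D' where D': "good (E - ?F) D'" "2 * card D' \<le> card (E - ?F)"
    unfolding half_bound_def by blast
  have "card ?F = 2" using \<open>u \<noteq> v\<close> ne by (simp add: doubleton_eq_iff)
  then have "half_bound E" if "good E (insert x D')" for x
    using half_extend[OF gr _ _ D'(2) that card_insert_le_Suc] in_E by simp
  with D'(1) show ?thesis by (rule that)
qed

text \<open>The pendant edge \<open>{s, z}\<close> is in \<open>D'\<close> or is seen through
  \<open>s\<close>, so \<open>D'\<close> covers \<open>s\<close>. As \<open>s\<close> and
  \<open>p\<close> are not adjacent, adding \<open>{x, s}\<close> makes \<open>{x, p}\<close>
  collide with nothing; it can fail only by spoiling two edges \<open>{t, p}\<close>,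
  \<open>{t, z'}\<close> that are pendant in \<open>E'\<close>. In that case \<open>{x, p}\<close>
  is added instead.\<close>

lemma half_deg2_support:
  assumes gr: "simple_graph E" and iso: "no_isolated E" and P: "pendant_path_free E"
    and T: "deg2_triangle_free E" and IH: "\<And>E'. E' \<subset> E \<Longrightarrow> no_isolated E' \<Longrightarrow> half_bound E'"
    and x: "inc E x = {{x, s}, {x, p}}" and "s \<noteq> p" and z: "inc E z = {{s, z}}"
  shows "half_bound E"
proof -
  let ?F = "{{x, s}, {x, p}}"
  define E' where "E' = E - ?F"
  obtain D' where good: "good E' D'" and half_bound: "\<And>h. good E (insert h D') \<Longrightarrow> half_bound E"
    using deg2_setup[OF gr iso P T IH x \<open>s \<noteq> p\<close>] unfolding E'_def by metis
  have x2: "inc E x = {{x, p}, {x, s}}" and E'2: "E' = E - {{x, p}, {x, s}}"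
    using x unfolding E'_def by (simp_all add: insert_commute)
  have D': "D' \<subseteq> E'" using good by (rule good_subset)
  have "simple_graph E'" "simple_graph D'" using simple_graph_subset[OF gr] D' by (auto simp: E'_def)
  have sp: "{s, p} \<notin> E" using deg2_triangle_freeD[OF T x \<open>s \<noteq> p\<close>] by blast
  have in_E: "{x, s} \<in> E" "{x, p} \<in> E" "{s, z} \<in> E" using x z by (auto simp: inc_def)
  have ne: "x \<noteq> s" "x \<noteq> p" "s \<noteq> z" using in_E gr simple_graph_no_loop by metis+
  have "z \<noteq> x"
  proof
    assume "z = x"
    then have "{{s, z}} = {{x, s}, {x, p}}" using x z by simp
    then have "{x, p} = {x, s}" by (metis insertI1 insertI2 singletonD)
    then show False using \<open>s \<noteq> p\<close> by (auto simp: doubleton_eq_iff)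
  qed
  have "z \<noteq> p" using sp in_E by auto
  have szE': "{s, z} \<in> E'" using in_E \<open>z \<noteq> x\<close> ne by (auto simp: E'_def doubleton_eq_iff)
  have Dz: "inc D' z \<subseteq> {{s, z}}" using z D' by (auto simp: E'_def inc_def)
  have Ds: "inc D' s \<noteq> {}"
  proof (cases "{s, z} \<in> D'")
    case True
    then show ?thesis using inc_pairI(1) by fastforce
  next
    case False
    then have "inc D' z = {}" using Dz by (auto simp: inc_def)
    then show ?thesis using good_nb[OF good szE' False] by (simp add: nb_pair)
  qed
  have twins: "\<exists>t z. e = {t, v} \<and> f = {t, z} \<and> inc E v = {{t, v}, {x, v}} \<and> inc E z = {{t, z}} \<and> z \<noteq> v"
    if "e \<in> E'" "f \<in> E'" "exempt E' e f" "u \<in> e \<longleftrightarrow> u \<in> f" "v \<in> e" "v \<notin> f"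
      "inc E x = {{x, u}, {x, v}}" "u \<noteq> v" "E' = E - {{x, u}, {x, v}}" for e f u v
    using deg2_twins[OF gr that(7,8,9) P T that(1,2,3,4,5,6)] .
  show ?thesis
  proof (cases "\<exists>e f. e \<in> E' - D' \<and> f \<in> E' - D' \<and> nb D' e = nb D' f \<and> exempt E' e f \<and>
      (s \<in> e \<longleftrightarrow> s \<in> f) \<and> p \<in> e \<and> p \<notin> f")
    case False
    have "good E (insert {x, s} D')"
    proof (rule reduce_deg2[OF gr x \<open>s \<noteq> p\<close> E'_def good])
      fix b
      show "inc D' s \<union> inc D' b \<noteq> inc D' p"
        using inc_common(2)[OF \<open>simple_graph D'\<close> _ _ \<open>s \<noteq> p\<close>] Ds sp D' unfolding E'_def by blast
    qed (use False in blast)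
    then show ?thesis by (rule half_bound)
  next
    case True
    then obtain e f where e: "e \<in> E'" "e \<notin> D'" and f: "f \<in> E'" "f \<notin> D'"
      and ef: "exempt E' e f" "s \<in> e \<longleftrightarrow> s \<in> f" "p \<in> e" "p \<notin> f" by blast
    obtain t z' where t: "e = {t, p}" "f = {t, z'}" "inc E p = {{t, p}, {x, p}}"
      "inc E z' = {{t, z'}}" "z' \<noteq> p"
      using twins[OF e(1) f(1) ef x \<open>s \<noteq> p\<close> E'_def] by blast
    have inE': "{t, p} \<in> E'" "{t, z'} \<in> E'" using e f t by auto
    then have inEt: "{t, p} \<in> E" "{t, z'} \<in> E" by (auto simp: E'_def)
    have "t \<noteq> s" using sp inEt by auto
    have "t \<noteq> p" "t \<noteq> z'" using inEt gr simple_graph_no_loop by metis+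
    have "good E (insert {x, p} D')"
    proof (rule reduce_deg2[OF gr x2 \<open>s \<noteq> p\<close>[symmetric] E'2 good])
      fix b assume b: "{p, b} \<in> E'" "{p, b} \<notin> D'"
      show "inc D' p \<union> inc D' b \<noteq> inc D' s"
      proof
        \<comment> \<open>The colliding edge must be \<open>{t, p}\<close>, and \<open>D'\<close>
          has no edge at \<open>p\<close>, so \<open>t\<close> and \<open>s\<close> have the same
          edges of \<open>D'\<close>, namely \<open>{t, s}\<close> alone. Then \<open>{s, z}\<close>
          and \<open>{t, z'}\<close> collide in \<open>E'\<close>, yet they are not exempt because
          \<open>t\<close> has the further neighbour \<open>p\<close>.\<close>
        assume eq: "inc D' p \<union> inc D' b = inc D' s"
        have "{p, b} \<in> {{t, p}, {x, p}}" using incD[OF t(3), of "{p, b}"] b by (auto simp: E'_def)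
        moreover have "{p, b} \<noteq> {x, p}" using b by (auto simp: E'_def insert_commute)
        ultimately have "b = t" by (auto simp: doubleton_eq_iff)
        have "inc D' p \<subseteq> inc E p \<inter> D' - {{x, p}}" using D' by (auto simp: inc_def E'_def)
        then have "inc D' p = {}" using t e by auto
        then have eq2: "inc D' t = inc D' s" using eq \<open>b = t\<close> by simp
        then obtain d where "d \<in> inc D' s" "d \<in> inc D' t" using Ds by blast
        then have ts: "{t, s} \<in> D'" using inc_common[OF \<open>simple_graph D'\<close> _ _ \<open>t \<noteq> s\<close>] by blast
        then have Dt: "inc D' t = {{t, s}}" using inc_only[OF \<open>simple_graph D'\<close> eq2] by simp
        have "z' \<noteq> s" using ts f t by auto
        have "{s, z} \<notin> D'"
        proof
          assume "{s, z} \<in> D'"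
          then have "{s, z} \<in> {{t, s}}" using inc_pairI(1)[of s z D'] eq2 Dt by simp
          then have "z = t" using ne by (auto simp: doubleton_eq_iff)
          then have "{t, p} \<in> {{s, z}}" using incD[OF z, of "{t, p}"] inEt by auto
          then show False using \<open>z = t\<close> \<open>s \<noteq> p\<close> \<open>t \<noteq> p\<close> by (auto simp: doubleton_eq_iff)
        qed
        then have "inc D' z = {}" using Dz by (auto simp: inc_def)
        moreover have "inc D' z' \<subseteq> {{t, z'}} \<inter> D'" using t(4) D' by (auto simp: inc_def E'_def)
        then have "inc D' z' = {}" using f t by auto
        ultimately have "nb D' {s, z} = nb D' {t, z'}" using eq2 by (simp add: nb_pair)
        moreover have "{s, z} \<noteq> {t, z'}"
          using \<open>t \<noteq> s\<close> \<open>z' \<noteq> s\<close> by (auto simp: doubleton_eq_iff)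
        ultimately have ex: "exempt E' {s, z} {t, z'}"
          using good_exempt[OF good szE' \<open>{s, z} \<notin> D'\<close> inE'(2)] f t by simp
        have "z \<noteq> t"
        proof
          assume "z = t"
          then have "{t, p} \<in> {{s, z}}" using incD[OF z, of "{t, p}"] inEt by auto
          then show False using \<open>z = t\<close> \<open>s \<noteq> p\<close> \<open>t \<noteq> p\<close> by (auto simp: doubleton_eq_iff)
        qed
        have "z \<noteq> z'"
        proof
          assume "z = z'"
          then have "{s, z} = {t, z'}" using z t(4) by auto
          then show False using \<open>{s, z} \<noteq> {t, z'}\<close> by simp
        qed
        have disj: "{s, z} \<inter> {t, z'} = {}"
          using \<open>t \<noteq> s\<close> \<open>z' \<noteq> s\<close> \<open>z \<noteq> t\<close> \<open>z \<noteq> z'\<close> by auto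
        have "{t, p} \<in> inc E' t" using inE' by (auto simp: inc_def)
        moreover have "t \<in> {t, z'}" "t \<notin> {s, z}" using disj by auto
        ultimately have "{t, p} \<subseteq> {t, z'} \<union> {s, z}"
          using exempt_nbrs[OF exempt_sym[OF ex]] by metis
        then show False using \<open>t \<noteq> p\<close> \<open>z' \<noteq> p\<close> \<open>s \<noteq> p\<close> \<open>z \<noteq> p\<close> by auto
      qed
    next
      fix e f assume e: "e \<in> E'" and f: "f \<in> E'" and *: "exempt E' e f" "p \<in> e \<longleftrightarrow> p \<in> f" "s \<in> e" "s \<notin> f"
      obtain t' y where y: "e = {t', s}" "f = {t', y}" "inc E s = {{t', s}, {x, s}}"
        using twins[OF e f * x2 \<open>s \<noteq> p\<close>[symmetric] E'2] by blast
      \<comment> \<open>The common end of a pair spoiled at \<open>s\<close> would be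
        \<open>z\<close>, but \<open>z\<close> carries no edge besides
        \<open>{s, z}\<close>.\<close>
      have "{s, z} \<in> {{t', s}, {x, s}}" using incD[OF y(3), of "{s, z}"] in_E by simp
      then have "t' = z" using \<open>z \<noteq> x\<close> ne by (auto simp: doubleton_eq_iff)
      moreover have "f \<in> E" using f by (simp add: E'_def)
      ultimately have "f \<in> {{s, z}}" using incD[OF z, of f] y by simp
      then show False using \<open>s \<notin> f\<close> by auto
    qed
    then show ?thesis by (rule half_bound)
  qed
qed

text \<open>If no degree-two vertex is adjacent to a vertex with a pendant neighbour, no pair can be
  spoiled, since by \<open>deg2_twins\<close> the vertex \<open>v\<close> would be such a one.
  Adding \<open>{w, u}\<close> then fails only if \<open>D'\<close> misses \<open>u\<close> and
  covers \<open>v\<close>, and adding \<open>{w, v}\<close> only in the opposite case; so one of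
  them works.\<close>

lemma half_deg2:
  assumes gr: "simple_graph E" and iso: "no_isolated E" and P: "pendant_path_free E"
    and T: "deg2_triangle_free E" and IH: "\<And>E'. E' \<subset> E \<Longrightarrow> no_isolated E' \<Longrightarrow> half_bound E'"
    and w: "inc E w = {{w, u}, {w, v}}" and "u \<noteq> v"
  shows "half_bound E"
proof (cases "\<exists>x s p z. inc E x = {{x, s}, {x, p}} \<and> s \<noteq> p \<and> inc E z = {{s, z}}")
  case True
  then show ?thesis using half_deg2_support[OF gr iso P T IH] by metis
next
  case no_support: False
  define E' where "E' = E - {{w, u}, {w, v}}"
  obtain D' where good: "good E' D'" and half_bound: "\<And>h. good E (insert h D') \<Longrightarrow> half_bound E"
    using deg2_setup[OF gr iso P T IH w \<open>u \<noteq> v\<close>] unfolding E'_def by metis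
  have w2: "inc E w = {{w, v}, {w, u}}" and E'2: "E' = E - {{w, v}, {w, u}}"
    using w unfolding E'_def by (simp_all add: insert_commute)
  have D': "D' \<subseteq> E'" using good by (rule good_subset)
  have "simple_graph E'" "simple_graph D'" using simple_graph_subset[OF gr] D' by (auto simp: E'_def)
  have uv: "{u, v} \<notin> E" using deg2_triangle_freeD[OF T w \<open>u \<noteq> v\<close>] by blast
  have ends_ne: "w \<noteq> u" "w \<noteq> v"
  proof -
    have "{w, u} \<in> E" "{w, v} \<in> E" using w by (auto simp: inc_def)
    then show "w \<noteq> u" "w \<noteq> v" using gr simple_graph_no_loop by metis+
  qed
  have twins: False
    if asm: "e \<in> E'" "f \<in> E'" "exempt E' e f" "a \<in> e \<longleftrightarrow> a \<in> f" "b \<in> e" "b \<notin> f"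
      "inc E w = {{w, a}, {w, b}}" "a \<noteq> b" "E' = E - {{w, a}, {w, b}}" for e f a b
  proof -
    obtain t z where t: "e = {t, b}" "inc E b = {{t, b}, {w, b}}" "inc E z = {{t, z}}"
      using deg2_twins[OF gr asm(7,8,9) P T asm(1,2,3,4,5,6)] by blast
    have "t \<noteq> w"
      using t(1) asm(1) unfolding asm(9) by (auto simp: insert_commute)
    moreover have "inc E b = {{b, t}, {b, w}}" using t(2) by (simp add: insert_commute)
    ultimately show False using no_support t(3) by blast
  qed
  have reduce: "half_bound E"
    if asm: "\<nexists>c. {a, c} \<in> E' \<and> {a, c} \<notin> D' \<and> inc D' a \<union> inc D' c = inc D' b"
      "inc E w = {{w, a}, {w, b}}" "a \<noteq> b" "E' = E - {{w, a}, {w, b}}" for a b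
  proof (rule half_bound, rule reduce_deg2[OF gr asm(2,3,4) good])
    show "inc D' a \<union> inc D' c \<noteq> inc D' b" if "{a, c} \<in> E'" "{a, c} \<notin> D'" for c
      using that asm(1) by blast
  qed (rule twins[OF _ _ _ _ _ _ asm(2,3,4)])
  have fail: "inc D' a = {} \<and> inc D' b \<noteq> {}"
    if c: "{a, c} \<in> E'" "{a, c} \<notin> D'" "inc D' a \<union> inc D' c = inc D' b" and ab: "a \<noteq> b" "{a, b} \<notin> E" for a b c
  proof
    have "{a, b} \<notin> D'" using ab D' by (auto simp: E'_def)
    then show "inc D' a = {}" using c(3) inc_common(2)[OF \<open>simple_graph D'\<close> _ _ \<open>a \<noteq> b\<close>] by blast
    show "inc D' b \<noteq> {}" using good_nb[OF good c(1,2)] c(3) by (simp add: nb_pair)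
  qed
  have vu: "{v, u} \<notin> E" using uv by (simp add: insert_commute)
  show ?thesis
    using reduce[OF _ w \<open>u \<noteq> v\<close> E'_def] reduce[OF _ w2 \<open>u \<noteq> v\<close>[symmetric] E'2]
      fail[OF _ _ _ \<open>u \<noteq> v\<close> uv] fail[OF _ _ _ \<open>u \<noteq> v\<close>[symmetric] vu] by metis
qed

section \<open>Graphs without vertices of degree two\<close>

locale no_deg2 =
  fixes E :: "'a set set"
  assumes gr: "simple_graph E" and iso: "no_isolated E" and deg: "card (inc E v) \<noteq> 2"
begin

section \<open>Minimal covers of the vertices of degree at least three, and the count\<close>

definition big :: "'a \<Rightarrow> bool" where
  "big v \<longleftrightarrow> 3 \<le> card (inc E v)"

text \<open>Minimality is expressed by a private end for each edge, the form in which exchanges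
  re-establish it. Only big vertices have to be covered, so the private end must be big.\<close>

definition minimal_cover :: "'a set set \<Rightarrow> bool" where
  "minimal_cover D \<longleftrightarrow> D \<subseteq> E \<and> (\<forall>v. big v \<longrightarrow> inc D v \<noteq> {}) \<and>
     (\<forall>d\<in>D. \<exists>x\<in>d. big x \<and> inc D x = {d})"

definition both_private :: "'a set set \<Rightarrow> 'a set set" where
  "both_private D = {d \<in> D. \<forall>x\<in>d. big x \<and> inc D x = {d}}"

lemma finite_E: "finite E"
  using gr by (simp add: simple_graph_def)

lemma finite_vertices: "finite (\<Union>E)"
proof (rule finite_Union[OF finite_E])
  fix e assume "e \<in> E"
  then have "card e > 0" using simple_graph_card[OF gr] by simp
  then show "finite e" by (rule card_ge_0_finite)
qed

lemma finite_inc: "finite (inc E v)"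
  using finite_E by (simp add: inc_def)

text \<open>Degree two being excluded, two edges at a vertex imply a third.\<close>

lemma bigI:
  assumes "e \<in> E" "f \<in> E" "e \<noteq> f" "v \<in> e" "v \<in> f"
  shows "big v"
proof -
  have "{e, f} \<subseteq> inc E v" using assms by (auto simp: inc_def)
  then have "card {e, f} \<le> card (inc E v)" using finite_inc by (rule card_mono[rotated])
  then show ?thesis using \<open>e \<noteq> f\<close> deg[of v] by (auto simp: big_def)
qed

lemma not_big:
  assumes "\<not> big v" "e \<in> E" "v \<in> e"
  shows "inc E v = {e}"
proof -
  have "f = e" if "f \<in> inc E v" for f
    using bigI[of f e v] that assms by (auto simp: inc_def)
  moreover have "e \<in> inc E v" using assms by (simp add: inc_def)
  ultimately show ?thesis by blast
qed

lemma ex_minimal_cover: "\<exists>D. minimal_cover D"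
proof -
  let ?cov = "\<lambda>D. D \<subseteq> E \<and> (\<forall>v. big v \<longrightarrow> inc D v \<noteq> {})"
  have "?cov E" by (auto simp: big_def)
  then obtain D where D: "?cov D" and min: "\<And>D'. ?cov D' \<Longrightarrow> card D \<le> card D'"
    using ex_has_least_nat[of ?cov E card] by blast
  have "finite D" using D finite_E finite_subset by blast
  have "\<exists>x\<in>d. big x \<and> inc D x = {d}" if "d \<in> D" for d
  proof -
    have "card (D - {d}) < card D" using \<open>finite D\<close> that by (rule card_Diff1_less)
    then have "\<not> ?cov (D - {d})" using min[of "D - {d}"] leD by metis
    then obtain x where x: "big x" "inc (D - {d}) x = {}" using D by blast
    then have "inc D x \<noteq> {}" "inc D x \<subseteq> {d}" using D by (auto simp: inc_Diff)
    then have "inc D x = {d}" by blast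
    moreover from this have "x \<in> d" by (auto simp: inc_def)
    ultimately show ?thesis using x by blast
  qed
  with D have "minimal_cover D" by (simp add: minimal_cover_def)
  then show ?thesis ..
qed

text \<open>Double counting with the set \<open>X\<close> of private ends. Each lies on at least two
  edges outside \<open>D\<close> and each edge has two ends, so \<open>X\<close> is no larger than
  \<open>E - D\<close>. On the other hand each edge of \<open>D\<close> contains a member of
  \<open>X\<close>, or two if it is in \<open>both_private D\<close>, and no member of
  \<open>X\<close> lies on two edges of \<open>D\<close>.\<close>

lemma card_minimal_cover:
  assumes "minimal_cover D"
  shows "2 * card D + card (both_private D) \<le> card E"
proof -
  have D: "D \<subseteq> E" using assms by (simp add: minimal_cover_def)
  have fin: "finite D" "finite (E - D)" using D finite_E finite_subset by auto
  define X where "X = {x. big x \<and> (\<exists>d\<in>D. inc D x = {d})}"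
  have X: "big x" "\<exists>d\<in>D. inc D x = {d}" if "x \<in> X" for x
    using that by (simp_all add: X_def)
  have "X \<subseteq> \<Union>E"
  proof
    fix x assume "x \<in> X"
    then obtain d where "d \<in> inc D x" unfolding X_def by blast
    then show "x \<in> \<Union>E" using D by (auto simp: in_inc_iff)
  qed
  then have "finite X" using finite_vertices by (rule finite_subset)
  have two: "card {x \<in> X. x \<in> e} \<le> 2" if "e \<in> E" for e
  proof -
    have "card e = 2" using gr that by (rule simple_graph_card)
    moreover from this have "finite e" by (intro card_ge_0_finite) simp
    ultimately show ?thesis using card_mono[of e "{x \<in> X. x \<in> e}"] by auto
  qed
  have swap: "(\<Sum>x\<in>X. card {e \<in> F. x \<in> e}) = (\<Sum>e\<in>F. card {x \<in> X. x \<in> e})" if "finite F" for F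
    using sum.swap_restrict[OF \<open>finite X\<close> that, of "\<lambda>_ _. 1::nat" "\<lambda>x e. x \<in> e"] by simp
  have "2 * card X \<le> (\<Sum>x\<in>X. card {e \<in> E - D. x \<in> e})"
  proof -
    have "2 \<le> card {e \<in> E - D. x \<in> e}" if x: "x \<in> X" for x
    proof -
      obtain d where d: "inc D x = {d}" using X(2)[OF x] by (elim bexE)
      have "big x" using x by (rule X)
      have "card (inc E x) = card (inc D x \<union> inc (E - D) x)"
        using D by (simp add: Un_absorb1 flip: inc_Un)
      also have "\<dots> \<le> 1 + card (inc (E - D) x)"
        using d card_Un_le[of "inc D x" "inc (E - D) x"] by simp
      finally have "card (inc E x) \<le> 1 + card {e \<in> E - D. x \<in> e}"
        by (simp add: inc_def)
      then show ?thesis using \<open>big x\<close> by (simp add: big_def)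
    qed
    then show ?thesis using sum_bounded_below[of X 2 "\<lambda>x. card {e \<in> E - D. x \<in> e}"] by simp
  qed
  also have "\<dots> = (\<Sum>e\<in>E - D. card {x \<in> X. x \<in> e})" using swap[OF fin(2)] .
  also have "\<dots> \<le> 2 * card (E - D)"
    using sum_bounded_above[of "E - D" "\<lambda>e. card {x \<in> X. x \<in> e}" 2] two by simp
  finally have X1: "card X \<le> card (E - D)" by simp
  have "card D + card (both_private D) = (\<Sum>d\<in>D. 1 + (if d \<in> both_private D then 1 else 0))"
  proof -
    have "both_private D = D \<inter> both_private D" by (auto simp: both_private_def)
    then have "card (both_private D) = (\<Sum>d\<in>D \<inter> both_private D. 1)" by simp
    also have "\<dots> = (\<Sum>d\<in>D. if d \<in> both_private D then 1 else 0)"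
      using fin by (intro sum.inter_restrict)
    finally show ?thesis unfolding sum.distrib by simp
  qed
  also have "\<dots> \<le> (\<Sum>d\<in>D. card {x \<in> X. x \<in> d})"
  proof (rule sum_mono)
    fix d assume d: "d \<in> D"
    obtain x where x: "x \<in> d" "big x" "inc D x = {d}" using assms d unfolding minimal_cover_def by blast
    have "finite {x \<in> X. x \<in> d}" using \<open>finite X\<close> by simp
    show "1 + (if d \<in> both_private D then 1 else 0) \<le> card {x \<in> X. x \<in> d}"
    proof (cases "d \<in> both_private D")
      case True
      then have "{x \<in> X. x \<in> d} = d" using d by (auto simp: both_private_def X_def)
      then show ?thesis using simple_graph_card[OF gr, of d] d D True by auto
    next
      case False
      have "x \<in> {x \<in> X. x \<in> d}" using x d by (auto simp: X_def)
      then have "card {x \<in> X. x \<in> d} > 0" using \<open>finite {x \<in> X. x \<in> d}\<close> card_gt_0_iff by blast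
      then show ?thesis using False by simp
    qed
  qed
  also have "\<dots> = (\<Sum>x\<in>X. card {e \<in> D. x \<in> e})" using swap[OF fin(1)] by simp
  also have "\<dots> = card X"
  proof -
    have "card {e \<in> D. x \<in> e} = 1" if x: "x \<in> X" for x
    proof -
      obtain d where "inc D x = {d}" using X(2)[OF x] by (elim bexE)
      then show ?thesis unfolding inc_def by simp
    qed
    then show ?thesis by simp
  qed
  finally have "card D + card (both_private D) \<le> card (E - D)" using X1 by simp
  moreover have "card E = card D + card (E - D)"
    using D finite_E by (metis card_Diff_subset card_mono fin(1) le_add_diff_inverse)
  ultimately show ?thesis by simp
qed

text \<open>The tie-break among the largest minimal covers: first produce stars that span a triangle,
  then centre them, if possible, at a vertex without pendant neighbour.\<close>

definition closed_centres :: "'a set set \<Rightarrow> 'a set" where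
  "closed_centres D = {c. \<exists>x y. x \<noteq> y \<and> inc D c = {{c, x}, {c, y}} \<and>
     inc D x = {{c, x}} \<and> inc D y = {{c, y}} \<and> {x, y} \<in> E}"

definition free_centres :: "'a set set \<Rightarrow> 'a set" where
  "free_centres D = {c \<in> closed_centres D. \<forall>z. inc E z \<noteq> {{c, z}}}"

text \<open>The two counts can simply be added: one even exchange raises the first without lowering
  the second, the other raises the second without lowering the first.\<close>

definition optimal :: "'a set set \<Rightarrow> bool" where
  "optimal D \<longleftrightarrow> minimal_cover D \<and> (\<forall>D'. minimal_cover D' \<longrightarrow> card D' \<le> card D) \<and>
     (\<forall>D'. minimal_cover D' \<longrightarrow> card D' = card D \<longrightarrow>
        card (closed_centres D') + card (free_centres D') \<le>
        card (closed_centres D) + card (free_centres D))"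

lemma ex_optimal: "\<exists>D. optimal D"
proof -
  have fin: "finite {D. minimal_cover D}"
    by (rule finite_subset[of _ "Pow E"]) (auto simp: minimal_cover_def finite_E)
  have max: "\<exists>x\<in>S. \<forall>y\<in>S. f y \<le> f x" if "finite S" "S \<noteq> {}" for S and f :: "'a set set \<Rightarrow> nat"
  proof -
    have "Max (f ` S) \<in> f ` S" using that by (intro Max_in) auto
    then obtain x where "x \<in> S" "f x = Max (f ` S)" by auto
    then show ?thesis using that by (intro bexI[of _ x]) auto
  qed
  obtain D1 where D1: "minimal_cover D1" "\<forall>D'\<in>{D. minimal_cover D}. card D' \<le> card D1"
    using max[OF fin] ex_minimal_cover by blast
  let ?S = "{D. minimal_cover D \<and> card D = card D1}"
  have "finite ?S" by (rule finite_subset[OF _ fin]) auto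
  then obtain D where "D \<in> ?S" "\<forall>D'\<in>?S. card (closed_centres D') + card (free_centres D') \<le>
        card (closed_centres D) + card (free_centres D)"
    using max[of ?S "\<lambda>D. card (closed_centres D) + card (free_centres D)"] D1 by blast
  then have "optimal D" using D1 by (simp add: optimal_def)
  then show ?thesis ..
qed

lemma finite_centres: "D \<subseteq> E \<Longrightarrow> finite (closed_centres D)" "D \<subseteq> E \<Longrightarrow> finite (free_centres D)"
proof -
  assume D: "D \<subseteq> E"
  have "c \<in> \<Union>E" if c: "c \<in> closed_centres D" for c
  proof -
    obtain x where "{c, x} \<in> inc D c" using c unfolding closed_centres_def by blast
    then show ?thesis using D by (auto simp: inc_def)
  qed
  then show "finite (closed_centres D)" using finite_vertices by (meson finite_subset subsetI)
  then show "finite (free_centres D)" by (simp add: free_centres_def)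
qed


lemma inc_empty: "inc {} v = {}"
  by (simp add: inc_def)

lemmas inc_mod = inc_Un inc_Diff inc_insert inc_empty

section \<open>Exchange arguments for optimal covers\<close>

lemma minimal_cover_private:
  assumes "minimal_cover D" "d \<in> D"
  obtains x where "x \<in> d" "big x" "inc D x = {d}"
  using assms unfolding minimal_cover_def by metis

lemma minimal_cover_subset: "minimal_cover D \<Longrightarrow> D \<subseteq> E"
  by (simp add: minimal_cover_def)

lemma uncovered:
  assumes "minimal_cover D" "inc D v = {}" "e \<in> E" "v \<in> e"
  shows "inc E v = {e}"
  using not_big assms unfolding minimal_cover_def by metis

text \<open>Deleting \<open>R\<close> can uncover only ends of \<open>R\<close>, and a private end
  of a surviving edge is lost only if an edge of \<open>N\<close> touches it. An exchange thus has
  to be checked only near \<open>R\<close> and \<open>N\<close>.\<close>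

lemma minimal_cover_modify:
  assumes D: "minimal_cover D" and "N \<subseteq> E"
    and cov: "\<And>v. big v \<Longrightarrow> v \<in> \<Union>R \<Longrightarrow> inc ((D - R) \<union> N) v \<noteq> {}"
    and new: "\<And>d. d \<in> N \<Longrightarrow> \<exists>x\<in>d. big x \<and> inc ((D - R) \<union> N) x = {d}"
    and old: "\<And>d. d \<in> D - R \<Longrightarrow> \<exists>x\<in>d. big x \<and>
      (inc D x = {d} \<and> x \<notin> \<Union>N \<or> inc ((D - R) \<union> N) x = {d})"
  shows "minimal_cover ((D - R) \<union> N)"
  unfolding minimal_cover_def
proof (intro conjI allI impI ballI)
  show "(D - R) \<union> N \<subseteq> E" using minimal_cover_subset[OF D] \<open>N \<subseteq> E\<close> by auto
next
  fix v assume v: "big v"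
  show "inc ((D - R) \<union> N) v \<noteq> {}"
  proof (cases "v \<in> \<Union>R")
    case True
    then show ?thesis using cov v by simp
  next
    case False
    then have "inc D v \<subseteq> inc ((D - R) \<union> N) v" by (auto simp: inc_def)
    then show ?thesis using D v unfolding minimal_cover_def by blast
  qed
next
  fix d assume "d \<in> (D - R) \<union> N"
  then consider "d \<in> N" | "d \<in> D - R" by blast
  then show "\<exists>x\<in>d. big x \<and> inc ((D - R) \<union> N) x = {d}"
  proof cases
    case 1
    then show ?thesis by (rule new)
  next
    case 2
    then obtain x where x: "x \<in> d" "big x"
      "inc D x = {d} \<and> x \<notin> \<Union>N \<or> inc ((D - R) \<union> N) x = {d}" using old by metis
    from x(3) have "inc ((D - R) \<union> N) x = {d}"
    proof
      assume *: "inc D x = {d} \<and> x \<notin> \<Union>N"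
      then have "inc N x = {}" by (auto simp: inc_def)
      then show ?thesis using * 2 by (auto simp: inc_mod)
    qed
    then show ?thesis using x(1,2) by metis
  qed
qed

lemma card_modify:
  assumes "D \<subseteq> E" "R \<subseteq> D" "N \<inter> D = {}" "finite N"
  shows "card ((D - R) \<union> N) + card R = card D + card N"
proof -
  have fin: "finite D" using assms finite_E finite_subset by blast
  then have "finite R" using assms finite_subset by blast
  have "card ((D - R) \<union> N) = card (D - R) + card N"
    by (rule card_Un_disjoint) (use fin assms in auto)
  moreover have "card (D - R) + card R = card D"
    using fin assms \<open>finite R\<close> by (metis card_Diff_subset card_mono diff_add)
  ultimately show ?thesis by simp
qed

lemma optimal_card: "optimal D \<Longrightarrow> minimal_cover D' \<Longrightarrow> card D' \<le> card D"
  by (simp add: optimal_def)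

lemma optimal_minimal_cover: "optimal D \<Longrightarrow> minimal_cover D"
  by (simp add: optimal_def)

text \<open>The exchange changes \<open>D\<close> only at vertices of \<open>W\<close>, and no
  closed star with a centre other than \<open>c'\<close> has its centre or a leaf there. At most one
  closed centre is therefore lost.\<close>

lemma closed_centres_transfer:
  assumes "c \<in> closed_centres D" and same: "\<And>v. v \<notin> W \<Longrightarrow> inc D' v = inc D v"
    and W: "\<And>v. v \<in> W \<Longrightarrow> v \<in> closed_centres D \<Longrightarrow> v = c'"
    and leaf: "\<And>x y. x \<in> W \<Longrightarrow> inc D x = {{y, x}} \<Longrightarrow> x \<noteq> y \<Longrightarrow> y \<in> closed_centres D \<Longrightarrow> y = c'"
    and "c \<noteq> c'"
    and gr_D: "simple_graph D"
  shows "c \<in> closed_centres D'"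
proof -
  obtain x y where xy: "x \<noteq> y" "inc D c = {{c, x}, {c, y}}" "inc D x = {{c, x}}"
      "inc D y = {{c, y}}" "{x, y} \<in> E"
    using \<open>c \<in> closed_centres D\<close> unfolding closed_centres_def by blast
  have "{c, x} \<in> inc D c" "{c, y} \<in> inc D c" by (simp_all add: xy(2))
  then have "{c, x} \<in> D" "{c, y} \<in> D" by (simp_all add: in_inc_iff)
  then have "c \<noteq> x" "c \<noteq> y" using simple_graph_no_loop[OF gr_D] by metis+
  have "c \<notin> W" using W[of c] assms(1,5) by argo
  moreover have "x \<notin> W" using leaf[OF _ xy(3)] \<open>c \<noteq> x\<close> assms(1,5) by metis
  moreover have "y \<notin> W" using leaf[OF _ xy(4)] \<open>c \<noteq> y\<close> assms(1,5) by metis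
  ultimately have "inc D' c = inc D c" "inc D' x = inc D x" "inc D' y = inc D y" using same by blast+
  then show ?thesis
    using xy unfolding closed_centres_def by (intro CollectI exI[of _ x] exI[of _ y]) simp
qed

lemma singleton_not_centre: "inc D v = {d} \<Longrightarrow> v \<notin> closed_centres D"
proof
  assume d: "inc D v = {d}" and "v \<in> closed_centres D"
  then obtain x y where xy: "x \<noteq> y" "inc D v = {{v, x}, {v, y}}"
    unfolding closed_centres_def by blast
  then have "{v, x} = {v, y}" using d by (metis insertI1 insertI2 singletonD)
  then show False using xy(1) by (simp add: doubleton_eq_iff)
qed

text \<open>Trading \<open>{v, w}\<close> for \<open>{u, v}\<close> and \<open>{u, w}\<close> gains
  an edge unless \<open>u\<close> was the only private end of some edge \<open>{u, c}\<close>, which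
  is then the only edge of \<open>D\<close> at \<open>u\<close>. If \<open>c\<close> is a closed
  centre, its other leaf is moved to \<open>u\<close> as well and the gain remains. Otherwise
  \<open>{u, c}\<close> is dropped too: the size is unchanged, but \<open>u\<close> becomes an
  additional closed centre, against the tie-break.\<close>

lemma no_common_neighbour:
  assumes opt: "optimal D" and "v \<noteq> w" and v: "inc D v = {{v, w}}" and w: "inc D w = {{v, w}}"
    and uv: "{u, v} \<in> E" and uw: "{u, w} \<in> E"
  shows False
proof -
  have D: "minimal_cover D" using opt by (rule optimal_minimal_cover)
  have DE: "D \<subseteq> E" using D by (rule minimal_cover_subset)
  have grD: "simple_graph D" using simple_graph_subset[OF gr DE] .
  have vwD: "{v, w} \<in> D" using v by (auto simp: inc_def)
  have ne: "u \<noteq> v" "u \<noteq> w" using uv uw simple_graph_no_loop[OF gr] by blast+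
  have neE: "{u, v} \<noteq> {u, w}" "{u, v} \<noteq> {v, w}" "{u, w} \<noteq> {v, w}"
    using ne \<open>v \<noteq> w\<close> by (auto simp: doubleton_eq_iff)
  have big: "big u" "big v" "big w"
    using bigI[OF uv uw neE(1), of u] bigI[OF uv _ neE(2), of v] bigI[OF uw _ neE(3), of w] vwD DE
    by auto
  have "{u, v} \<notin> D" using incD[OF v, of "{u, v}"] neE by auto
  moreover have "{u, w} \<notin> D" using incD[OF w, of "{u, w}"] neE by auto
  ultimately have N: "{{u, v}, {u, w}} \<inter> D = {}" by simp
  have cardN: "card {{u, v}, {u, w}} = 2" using neE by simp
  show False
  proof (cases "\<forall>d\<in>inc D u. \<exists>x\<in>d. x \<noteq> u \<and> big x \<and> inc D x = {d}")
    case True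
    have "minimal_cover ((D - {{v, w}}) \<union> {{u, v}, {u, w}})"
    proof (rule minimal_cover_modify[OF D])
      fix d assume d: "d \<in> {{u, v}, {u, w}}"
      have "inc ((D - {{v, w}}) \<union> {{u, v}, {u, w}}) v = {{u, v}}"
        "inc ((D - {{v, w}}) \<union> {{u, v}, {u, w}}) w = {{u, w}}"
        using ne \<open>v \<noteq> w\<close> by (simp_all add: inc_mod v w)
      then show "\<exists>x\<in>d. big x \<and> inc ((D - {{v, w}}) \<union> {{u, v}, {u, w}}) x = {d}"
        using d big by auto
    next
      fix d assume d: "d \<in> D - {{v, w}}"
      obtain x where x: "x \<in> d" "big x" "inc D x = {d}" "x \<noteq> u"
      proof (cases "d \<in> inc D u")
        case True
        then show ?thesis using \<open>\<forall>d\<in>inc D u. _ d\<close> that by blast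
      next
        case False
        obtain x where "x \<in> d" "big x" "inc D x = {d}" using minimal_cover_private[OF D, of d] d by blast
        then show ?thesis using that False d by (auto simp: in_inc_iff)
      qed
      moreover have "x \<noteq> v" "x \<noteq> w" using x(3) v w d by auto
      ultimately have "x \<notin> \<Union>{{u, v}, {u, w}}" by simp
      then show "\<exists>x\<in>d. big x \<and> (inc D x = {d} \<and> x \<notin> \<Union>{{u, v}, {u, w}} \<or>
          inc ((D - {{v, w}}) \<union> {{u, v}, {u, w}}) x = {d})"
        using x by metis
    qed (use uv uw in \<open>auto simp: inc_mod\<close>)
    from optimal_card[OF opt this] show False
      using card_modify[OF DE, of "{{v, w}}" "{{u, v}, {u, w}}"] vwD N cardN by simp
  next
    case False
    then obtain d where d: "d \<in> inc D u" and no: "\<not> (\<exists>x\<in>d. x \<noteq> u \<and> big x \<and> inc D x = {d})" by blast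
    then have dD: "d \<in> D" "u \<in> d" by (auto simp: inc_def)
    then obtain c where c: "d = {u, c}" "c \<noteq> u" using simple_graph_edge_at[OF grD] by metis
    obtain x where "x \<in> d" "big x" "inc D x = {d}" using minimal_cover_private[OF D dD(1)] .
    then have Du: "inc D u = {{u, c}}" using no c by metis
    have ucD: "{u, c} \<in> D" using dD c by simp
    have Dc: "\<not> (big c \<and> inc D c = {{u, c}})" using no c by auto
    have "c \<noteq> v" using N ucD by auto
    have "c \<noteq> w" using N ucD by auto
    show False
    proof (cases "c \<in> closed_centres D")
      case True
      then obtain x y where xy: "x \<noteq> y" "inc D c = {{c, x}, {c, y}}" "inc D x = {{c, x}}"
        "inc D y = {{c, y}}" "{x, y} \<in> E"
        unfolding closed_centres_def by blast
      have "{u, c} \<in> {{c, x}, {c, y}}" using incD[OF xy(2) ucD] by simp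
      then have "u = x \<or> u = y" using c(2) by (auto simp: doubleton_eq_iff)
      then obtain t where t: "t \<noteq> u" "inc D c = {{c, u}, {c, t}}" "inc D t = {{c, t}}" "{u, t} \<in> E"
      proof
        assume "u = x"
        then show ?thesis using xy that[of y] by simp
      next
        assume "u = y"
        then show ?thesis using xy that[of x] by (simp add: insert_commute)
      qed
      have ctD: "{c, t} \<in> D" using t(2) by (auto simp: inc_def)
      have "c \<noteq> t" using simple_graph_no_loop[OF grD ctD] .
      have "t \<noteq> v"
      proof
        assume "t = v"
        then have "{c, v} = {v, w}" using t(3) v by simp
        then show False using \<open>c \<noteq> w\<close> \<open>c \<noteq> v\<close> by (auto simp: doubleton_eq_iff)
      qed
      have "t \<noteq> w"
      proof
        assume "t = w"
        then have "{c, w} = {v, w}" using t(3) w by simp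
        then show False using \<open>c \<noteq> w\<close> \<open>c \<noteq> v\<close> by (auto simp: doubleton_eq_iff)
      qed
      have ctE: "{c, u} \<in> E" "{c, t} \<in> E" using ucD ctD DE by (auto simp: insert_commute)
      have ct_ne: "{c, u} \<noteq> {c, t}" "{c, t} \<noteq> {u, t}"
        using t(1) c(2) \<open>c \<noteq> t\<close> by (auto simp: doubleton_eq_iff)
      have big2: "big c" "big t"
        using bigI[OF ctE ct_ne(1), of c] bigI[OF ctE(2) t(4) ct_ne(2), of t] by auto
      have utD: "{u, t} \<notin> D" using incD[OF t(3), of "{u, t}"] ct_ne by auto
      \<comment> \<open>Two edges out, three in. The edge \<open>{u, c}\<close> stays: with
        \<open>{c, t}\<close> gone, \<open>c\<close> has no other edge of the cover and becomes its
        private end.\<close>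
      let ?R = "{{v, w}, {c, t}}" and ?N = "{{u, v}, {u, w}, {u, t}}"
      have "{u, c} \<notin> ?R" using \<open>c \<noteq> v\<close> \<open>c \<noteq> w\<close> ct_ne(1) by (auto simp: insert_commute)
      have "{v, w} \<noteq> {c, t}" using \<open>c \<noteq> v\<close> \<open>c \<noteq> w\<close> by (auto simp: doubleton_eq_iff)
      then have "card ?R = 2" by simp
      have "{u, v} \<noteq> {u, t}" "{u, w} \<noteq> {u, t}"
        using \<open>t \<noteq> v\<close> \<open>t \<noteq> w\<close> t(1) by (simp_all add: doubleton_eq_iff)
      then have "card ?N = 3" using neE(1) by simp
      note cards = \<open>card ?R = 2\<close> \<open>card ?N = 3\<close>
      have "minimal_cover ((D - ?R) \<union> ?N)"
      proof (rule minimal_cover_modify[OF D])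
        show "?N \<subseteq> E" using uv uw t by simp
      next
        fix z assume "big z" "z \<in> \<Union>?R"
        then have "z \<in> {v, w, c, t}" by auto
        moreover have "{u, v} \<in> inc ((D - ?R) \<union> ?N) v" "{u, w} \<in> inc ((D - ?R) \<union> ?N) w"
          "{u, t} \<in> inc ((D - ?R) \<union> ?N) t" by (simp_all add: in_inc_iff)
        moreover have "{u, c} \<in> inc ((D - ?R) \<union> ?N) c"
          using ucD \<open>{u, c} \<notin> ?R\<close> by (simp add: in_inc_iff)
        ultimately show "inc ((D - ?R) \<union> ?N) z \<noteq> {}" by auto
      next
        fix d assume d: "d \<in> ?N"
        have "inc ((D - ?R) \<union> ?N) v = {{u, v}}" "inc ((D - ?R) \<union> ?N) w = {{u, w}}"
          "inc ((D - ?R) \<union> ?N) t = {{u, t}}"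
          using ne \<open>v \<noteq> w\<close> t(1) \<open>t \<noteq> v\<close> \<open>t \<noteq> w\<close> by (simp_all add: inc_mod v w t(3))
        then show "\<exists>x\<in>d. big x \<and> inc ((D - ?R) \<union> ?N) x = {d}"
          using d big big2 by auto
      next
        fix d assume d: "d \<in> D - ?R"
        show "\<exists>x\<in>d. big x \<and> (inc D x = {d} \<and> x \<notin> \<Union>?N \<or> inc ((D - ?R) \<union> ?N) x = {d})"
        proof (cases "d = {u, c}")
          case True
          have "inc ((D - ?R) \<union> ?N) c = {{c, u}}"
            using \<open>c \<noteq> v\<close> \<open>c \<noteq> w\<close> \<open>c \<noteq> t\<close> c(2) ct_ne(1) \<open>{u, c} \<notin> ?R\<close>
            by (simp add: inc_mod t(2) insert_Diff_if insert_commute)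
          then show ?thesis using True big2(1) by (auto simp: insert_commute)
        next
          case False
          obtain x where x: "x \<in> d" "big x" "inc D x = {d}" using minimal_cover_private[OF D, of d] d by blast
          have "x \<noteq> u" using x(3) Du False by auto
          moreover have "x \<noteq> v" "x \<noteq> w" "x \<noteq> t" using x(3) v w t(3) d by auto
          ultimately have "x \<notin> \<Union>?N" by simp
          then show ?thesis using x by metis
        qed
      qed
      from optimal_card[OF opt this] show False
        using card_modify[OF DE, of ?R ?N] vwD ctD N utD cards by simp
    next
      case notc: False
      let ?R = "{{v, w}, {u, c}}" and ?N = "{{u, v}, {u, w}}"
      let ?D = "(D - ?R) \<union> ?N"
      have mem: "{u, v} \<in> inc ?D v" "{u, w} \<in> inc ?D w" "{u, v} \<in> inc ?D u"
        by (simp_all add: in_inc_iff)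
      have inc_D: "inc ?D v = {{u, v}}" "inc ?D w = {{u, w}}" "inc ?D u = {{u, v}, {u, w}}"
        using ne \<open>v \<noteq> w\<close> \<open>c \<noteq> v\<close> \<open>c \<noteq> w\<close> by (simp_all add: inc_mod v w Du)
      have D1: "minimal_cover ?D"
      proof (rule minimal_cover_modify[OF D])
        show "?N \<subseteq> E" using uv uw by simp
      next
        fix z assume z: "big z" "z \<in> \<Union>?R"
        show "inc ?D z \<noteq> {}"
        proof (cases "z = c")
          case True
          \<comment> \<open>Being big but not a private end of \<open>{u, c}\<close>, the vertex
            \<open>c\<close> has another edge of \<open>D\<close>, and this edge survives.\<close>
          then have "inc D c \<noteq> {{u, c}}" using Dc z by simp
          moreover have "{u, c} \<in> inc D c" using ucD by (simp add: in_inc_iff)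
          ultimately obtain d' where "d' \<in> inc D c" "d' \<noteq> {u, c}" by blast
          moreover have "d' \<noteq> {v, w}" if "c \<in> d'" using that \<open>c \<noteq> v\<close> \<open>c \<noteq> w\<close> by auto
          ultimately have "d' \<in> inc ?D c" by (simp add: in_inc_iff)
          then show ?thesis using True by auto
        next
          case False
          then have "z \<in> {v, w, u}" using z by auto
          then show ?thesis using mem by auto
        qed
      next
        fix d assume "d \<in> ?N"
        then show "\<exists>x\<in>d. big x \<and> inc ?D x = {d}" using inc_D big by auto
      next
        fix d assume d: "d \<in> D - ?R"
        obtain x where x: "x \<in> d" "big x" "inc D x = {d}" using minimal_cover_private[OF D, of d] d by blast
        have "x \<noteq> u" "x \<noteq> v" "x \<noteq> w" using x(3) v w Du d by auto
        then have "x \<notin> \<Union>?N" by simp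
        then show "\<exists>x\<in>d. big x \<and> (inc D x = {d} \<and> x \<notin> \<Union>?N \<or> inc ?D x = {d})"
          using x by metis
      qed
      have "{v, w} \<noteq> {u, c}" using ne by (auto simp: doubleton_eq_iff)
      then have "card ?D = card D"
        using card_modify[OF DE, of ?R ?N] vwD ucD N cardN by simp
      have not_centre: "u \<notin> closed_centres D" "v \<notin> closed_centres D" "w \<notin> closed_centres D"
        using singleton_not_centre[OF Du] singleton_not_centre[OF v] singleton_not_centre[OF w]
        by simp_all
      have sub: "closed_centres D \<subseteq> closed_centres ?D"
      proof
        fix a assume a: "a \<in> closed_centres D"
        show "a \<in> closed_centres ?D"
        proof (rule closed_centres_transfer[OF a, of "{u, v, w, c}" _ c])
          fix z assume "z \<notin> {u, v, w, c}"
          then show "inc ?D z = inc D z" by (auto simp: in_inc_iff)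
        next
          fix z assume "z \<in> {u, v, w, c}" "z \<in> closed_centres D"
          then show "z = c" using not_centre by auto
        next
          fix x y assume x: "x \<in> {u, v, w, c}" "inc D x = {{y, x}}" "x \<noteq> y" "y \<in> closed_centres D"
          have y: "y \<noteq> u" "y \<noteq> v" "y \<noteq> w" using x(4) not_centre by auto
          from x(1) consider "x = u" | "x = v" | "x = w" | "x = c" by blast
          then show "y = c"
          proof cases
            case 1
            then have "{y, u} = {u, c}" using x(2) Du by simp
            then show ?thesis using y by (auto simp: doubleton_eq_iff)
          next
            case 2
            then have "{y, v} = {v, w}" using x(2) v by simp
            then show ?thesis using y by (auto simp: doubleton_eq_iff)
          next
            case 3
            then have "{y, w} = {v, w}" using x(2) w by simp
            then show ?thesis using y by (auto simp: doubleton_eq_iff)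
          next
            case 4
            then have "{u, c} \<in> {{y, c}}" using incD[OF x(2) ucD] by simp
            then show ?thesis using y by (auto simp: doubleton_eq_iff)
          qed
        next
          show "a \<noteq> c" using a notc by auto
        qed (rule grD)
      qed
      have "u \<in> closed_centres ?D"
        unfolding closed_centres_def
        by (intro CollectI exI[of _ v] exI[of _ w] conjI inc_D \<open>v \<noteq> w\<close>) (use vwD DE in auto)
      then have "insert u (closed_centres D) \<subseteq> closed_centres ?D" using sub by simp
      then have "card (insert u (closed_centres D)) \<le> card (closed_centres ?D)"
        using finite_centres(1)[OF minimal_cover_subset[OF D1]] by (rule card_mono[rotated])
      then have "card (closed_centres D) < card (closed_centres ?D)"
        using not_centre finite_centres(1)[OF DE] by simp
      moreover have "free_centres D \<subseteq> free_centres ?D" using sub by (auto simp: free_centres_def)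
      then have "card (free_centres D) \<le> card (free_centres ?D)"
        using finite_centres(2)[OF minimal_cover_subset[OF D1]] by (rule card_mono[rotated])
      ultimately show False using opt D1 \<open>card ?D = card D\<close> unfolding optimal_def by fastforce
    qed
  qed
qed


text \<open>Trading \<open>{u, x}\<close> for \<open>{u, v}\<close> and \<open>{x, y}\<close> gains
  an edge: \<open>u\<close> and \<open>x\<close> become private ends of the new edges, and no old
  edge had its private end at \<open>v\<close> or \<open>y\<close>, which \<open>D\<close>
  misses.\<close>

lemma no_double_pendant:
  assumes opt: "optimal D" and u: "inc D u = {{u, x}}" and x: "inc D x = {{u, x}}"
    and v: "inc D v = {}" and y: "inc D y = {}" and uv: "{u, v} \<in> E" and xy: "{x, y} \<in> E"
  shows False
proof -
  have D: "minimal_cover D" using opt by (rule optimal_minimal_cover)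
  have DE: "D \<subseteq> E" using D by (rule minimal_cover_subset)
  have "{u, x} \<in> inc D u" by (simp add: u)
  then have uxD: "{u, x} \<in> D" by (simp add: in_inc_iff)
  have "u \<noteq> x" using simple_graph_no_loop[OF simple_graph_subset[OF gr DE] uxD] .
  have "{u, v} \<notin> D" using v by (auto simp: inc_def)
  moreover have "{x, y} \<notin> D" using y by (auto simp: inc_def)
  ultimately have N: "{{u, v}, {x, y}} \<inter> D = {}" by simp
  have ne: "y \<noteq> u" "y \<noteq> x" "v \<noteq> u" "v \<noteq> x" using u x v y by auto
  have neE: "{u, v} \<noteq> {u, x}" "{x, y} \<noteq> {u, x}" "{u, v} \<noteq> {x, y}"
    using ne \<open>u \<noteq> x\<close> by (auto simp: doubleton_eq_iff)
  have uxE: "{u, x} \<in> E" using uxD DE by auto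
  have big: "big u" "big x"
    using bigI[OF uv uxE neE(1), of u] bigI[OF xy uxE neE(2), of x] by auto
  let ?R = "{{u, x}}" and ?N = "{{u, v}, {x, y}}"
  let ?D = "(D - ?R) \<union> ?N"
  have inc_D: "inc ?D u = {{u, v}}" "inc ?D x = {{x, y}}"
    using ne \<open>u \<noteq> x\<close> by (simp_all add: inc_mod u x)
  have "minimal_cover ?D"
  proof (rule minimal_cover_modify[OF D])
    show "?N \<subseteq> E" using uv xy by simp
  next
    fix z assume "z \<in> \<Union>?R"
    then show "inc ?D z \<noteq> {}" using inc_D by auto
  next
    fix d assume "d \<in> ?N"
    then show "\<exists>x\<in>d. big x \<and> inc ?D x = {d}" using inc_D big by auto
  next
    fix d assume d: "d \<in> D - ?R"
    obtain z where z: "z \<in> d" "big z" "inc D z = {d}" using minimal_cover_private[OF D, of d] d by blast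
    then have "z \<noteq> u" "z \<noteq> x" "z \<noteq> v" "z \<noteq> y" using u x v y d by auto
    then have "z \<notin> \<Union>?N" by simp
    then show "\<exists>x\<in>d. big x \<and> (inc D x = {d} \<and> x \<notin> \<Union>?N \<or> inc ?D x = {d})"
      using z by metis
  qed
  from optimal_card[OF opt this] show False
    using card_modify[OF DE, of ?R ?N] uxD N neE(3) by simp
qed

text \<open>Trading \<open>{u, y}\<close> for \<open>{x, y}\<close> moves the centre of the star
  from \<open>u\<close> to \<open>x\<close>, with no change of size and no drop in closed centres.
  Because of \<open>v\<close>, the old centre is not free; if \<open>x\<close> had no pendant
  neighbour, the new one would be, against the tie-break.\<close>

lemma closed_star_leaf_pendant:
  assumes opt: "optimal D" and "x \<noteq> y" and u: "inc D u = {{u, x}, {u, y}}"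
    and x: "inc D x = {{u, x}}" and y: "inc D y = {{u, y}}" and xy: "{x, y} \<in> E"
    and pend: "inc E v = {{u, v}}" and v: "inc D v = {}"
  shows "\<exists>p. inc E p = {{x, p}}"
proof (rule ccontr)
  assume no: "\<nexists>p. inc E p = {{x, p}}"
  have D: "minimal_cover D" using opt by (rule optimal_minimal_cover)
  have DE: "D \<subseteq> E" using D by (rule minimal_cover_subset)
  have grD: "simple_graph D" using simple_graph_subset[OF gr DE] .
  have "{u, x} \<in> inc D u" "{u, y} \<in> inc D u" by (simp_all add: u)
  then have uD: "{u, x} \<in> D" "{u, y} \<in> D" by (simp_all add: in_inc_iff)
  then have ne: "u \<noteq> x" "u \<noteq> y" using simple_graph_no_loop[OF grD] by metis+
  have neE: "{u, x} \<noteq> {u, y}" "{x, y} \<noteq> {u, x}" "{x, y} \<noteq> {u, y}"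
    using ne \<open>x \<noteq> y\<close> by (auto simp: doubleton_eq_iff)
  have uE: "{u, x} \<in> E" "{u, y} \<in> E" using uD DE by auto
  have big: "big u" "big x" "big y"
    using bigI[OF uE neE(1), of u] bigI[OF xy uE(1) neE(2), of x] bigI[OF xy uE(2) neE(3), of y]
    by auto
  have xyD: "{x, y} \<notin> D" using incD[OF x, of "{x, y}"] neE by auto
  let ?R = "{{u, y}}" and ?N = "{{x, y}}"
  let ?D = "(D - ?R) \<union> ?N"
  have inc_D: "inc ?D u = {{u, x}}" "inc ?D y = {{x, y}}" "inc ?D x = {{x, u}, {x, y}}"
    using ne neE \<open>x \<noteq> y\<close> by (simp_all add: inc_mod u x y insert_Diff_if insert_commute)
  have D1: "minimal_cover ?D"
  proof (rule minimal_cover_modify[OF D])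
    show "?N \<subseteq> E" using xy by simp
  next
    fix z assume "z \<in> \<Union>?R"
    then show "inc ?D z \<noteq> {}" using inc_D by auto
  next
    fix d assume "d \<in> ?N"
    then show "\<exists>x\<in>d. big x \<and> inc ?D x = {d}" using inc_D big by auto
  next
    fix d assume d: "d \<in> D - ?R"
    show "\<exists>x\<in>d. big x \<and> (inc D x = {d} \<and> x \<notin> \<Union>?N \<or> inc ?D x = {d})"
    proof (cases "d = {u, x}")
      case True
      then show ?thesis using inc_D(1) big(1) by auto
    next
      case False
      obtain z where z: "z \<in> d" "big z" "inc D z = {d}" using minimal_cover_private[OF D, of d] d by blast
      then have "z \<noteq> x" "z \<noteq> y" using x y d False by auto
      then have "z \<notin> \<Union>?N" by simp
      then show ?thesis using z by metis
    qed
  qed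
  have cardD: "card ?D = card D" using card_modify[OF DE, of ?R ?N] uD xyD by simp
  have xyc: "x \<notin> closed_centres D" "y \<notin> closed_centres D"
    using singleton_not_centre[OF x] singleton_not_centre[OF y] by simp_all
  have sub: "closed_centres D - {u} \<subseteq> closed_centres ?D"
  proof
    fix a assume a: "a \<in> closed_centres D - {u}"
    then have a': "a \<in> closed_centres D" by simp
    show "a \<in> closed_centres ?D"
    proof (rule closed_centres_transfer[OF a', of "{u, x, y}" _ u])
      fix z assume "z \<notin> {u, x, y}"
      then show "inc ?D z = inc D z" by (auto simp: in_inc_iff)
    next
      fix z assume "z \<in> {u, x, y}" "z \<in> closed_centres D"
      then show "z = u" using xyc by auto
    next
      fix p q assume p: "p \<in> {u, x, y}" "inc D p = {{q, p}}" "p \<noteq> q" "q \<in> closed_centres D"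
      from p(1) consider "p = u" | "p = x" | "p = y" by blast
      then show "q = u"
      proof cases
        case 1
        then have "{u, x} \<in> {{q, u}}" using incD[OF p(2) uD(1)] by simp
        then show ?thesis using p(4) xyc ne by (auto simp: doubleton_eq_iff)
      next
        case 2
        then have "{q, x} = {u, x}" using p(2) x by simp
        then show ?thesis by (auto simp: doubleton_eq_iff)
      next
        case 3
        then have "{q, y} = {u, y}" using p(2) y by simp
        then show ?thesis by (auto simp: doubleton_eq_iff)
      qed
    next
      show "a \<noteq> u" using a by simp
    qed (rule grD)
  qed
  have x_centre: "x \<in> closed_centres ?D"
    unfolding closed_centres_def
    by (intro CollectI exI[of _ u] exI[of _ y] conjI inc_D(3) ne(2) uE(2))
      (use inc_D in \<open>simp_all add: insert_commute\<close>)
  have u_centre: "u \<in> closed_centres D"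
    unfolding closed_centres_def
    by (intro CollectI exI[of _ x] exI[of _ y] conjI u x y \<open>x \<noteq> y\<close> xy)
  have fin: "finite (closed_centres D)" "finite (free_centres D)"
    "finite (closed_centres ?D)" "finite (free_centres ?D)"
    using finite_centres DE minimal_cover_subset[OF D1] by simp_all
  have "card (insert x (closed_centres D - {u})) \<le> card (closed_centres ?D)"
    using fin(3) by (rule card_mono) (use x_centre sub in simp)
  moreover have "card (closed_centres D - {u}) + 1 = card (closed_centres D)"
    using u_centre fin(1) by (metis Suc_eq_plus1 card_Suc_Diff1)
  ultimately have c1: "card (closed_centres D) \<le> card (closed_centres ?D)"
    using xyc fin(1) by simp
  have "u \<notin> free_centres D" using pend by (auto simp: free_centres_def)
  then have "insert x (free_centres D) \<subseteq> free_centres ?D"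
    using sub x_centre no by (auto simp: free_centres_def)
  then have "card (insert x (free_centres D)) \<le> card (free_centres ?D)"
    using fin(4) by (rule card_mono[rotated])
  moreover have "x \<notin> free_centres D" using xyc by (simp add: free_centres_def)
  ultimately have "card (free_centres D) < card (free_centres ?D)" using fin(2) by simp
  then show False using opt D1 cardD c1 unfolding optimal_def by fastforce
qed

text \<open>Applied to both leaves, \<open>closed_star_leaf_pendant\<close> gives every vertex of
  the triangle a pendant neighbour. The three pendant edges can then replace the two star edges,
  which contradicts maximality.\<close>

lemma no_closed_star_pendant:
  assumes opt: "optimal D" and "x \<noteq> y" and u: "inc D u = {{u, x}, {u, y}}"
    and x: "inc D x = {{u, x}}" and y: "inc D y = {{u, y}}" and xy: "{x, y} \<in> E"
    and uv: "{u, v} \<in> E" and v: "inc D v = {}"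
  shows False
proof -
  have D: "minimal_cover D" using opt by (rule optimal_minimal_cover)
  have DE: "D \<subseteq> E" using D by (rule minimal_cover_subset)
  have grD: "simple_graph D" using simple_graph_subset[OF gr DE] .
  have pend: "inc E v = {{u, v}}" using uncovered[OF D v uv] by simp
  obtain p where p: "inc E p = {{x, p}}"
    using closed_star_leaf_pendant[OF opt \<open>x \<noteq> y\<close> u x y xy pend v] by metis
  have u2: "inc D u = {{u, y}, {u, x}}" and yx: "{y, x} \<in> E"
    using u xy by (simp_all add: insert_commute)
  obtain q where q: "inc E q = {{y, q}}"
    using closed_star_leaf_pendant[OF opt \<open>x \<noteq> y\<close>[symmetric] u2 y x yx pend v] by metis
  have "{u, x} \<in> inc D u" "{u, y} \<in> inc D u" by (simp_all add: u)
  then have uD: "{u, x} \<in> D" "{u, y} \<in> D" by (simp_all add: in_inc_iff)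
  then have ne: "u \<noteq> x" "u \<noteq> y" using simple_graph_no_loop[OF grD] by metis+
  have neE: "{u, x} \<noteq> {u, y}" "{x, y} \<noteq> {u, x}" "{x, y} \<noteq> {u, y}"
    using ne \<open>x \<noteq> y\<close> by (auto simp: doubleton_eq_iff)
  have uE: "{u, x} \<in> E" "{u, y} \<in> E" using uD DE by auto
  have big: "big u" "big x" "big y"
    using bigI[OF uE neE(1), of u] bigI[OF xy uE(1) neE(2), of x] bigI[OF xy uE(2) neE(3), of y]
    by auto
  have small: "\<not> big v" "\<not> big p" "\<not> big q" using pend p q by (simp_all add: big_def)
  have dist: "v \<noteq> u" "v \<noteq> x" "v \<noteq> y" "p \<noteq> u" "p \<noteq> x" "p \<noteq> y" "q \<noteq> u" "q \<noteq> x" "q \<noteq> y"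
    using small big by auto
  have "{x, p} \<in> inc E p" "{y, q} \<in> inc E q" by (simp_all add: p q)
  then have pq: "{x, p} \<in> E" "{y, q} \<in> E" by (simp_all add: in_inc_iff)
  have "{u, v} \<notin> D" using v by (auto simp: inc_def)
  moreover have "{x, p} \<notin> D" using incD[OF x, of "{x, p}"] dist by (auto simp: doubleton_eq_iff)
  moreover have "{y, q} \<notin> D" using incD[OF y, of "{y, q}"] dist by (auto simp: doubleton_eq_iff)
  ultimately have N: "{{u, v}, {x, p}, {y, q}} \<inter> D = {}" by simp
  have "{u, v} \<noteq> {x, p}" "{u, v} \<noteq> {y, q}" "{x, p} \<noteq> {y, q}"
    using dist ne \<open>x \<noteq> y\<close> by (simp_all add: doubleton_eq_iff)
  then have cardN: "card {{u, v}, {x, p}, {y, q}} = 3" by simp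
  let ?R = "{{u, x}, {u, y}}" and ?N = "{{u, v}, {x, p}, {y, q}}"
  let ?D = "(D - ?R) \<union> ?N"
  have inc_D: "inc ?D u = {{u, v}}" "inc ?D x = {{x, p}}" "inc ?D y = {{y, q}}"
    using ne \<open>x \<noteq> y\<close> dist by (simp_all add: inc_mod u x y)
  have "minimal_cover ?D"
  proof (rule minimal_cover_modify[OF D])
    show "?N \<subseteq> E" using uv pq by simp
  next
    fix z assume "z \<in> \<Union>?R"
    then show "inc ?D z \<noteq> {}" using inc_D by auto
  next
    fix d assume "d \<in> ?N"
    then show "\<exists>x\<in>d. big x \<and> inc ?D x = {d}" using inc_D big by auto
  next
    fix d assume d: "d \<in> D - ?R"
    obtain z where z: "z \<in> d" "big z" "inc D z = {d}" using minimal_cover_private[OF D, of d] d by blast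
    have "{u, x} \<in> {d}" if "z = u" using z(3) u that by auto
    then have "z \<noteq> u" using d by auto
    moreover have "z \<noteq> x" "z \<noteq> y" using z x y d by auto
    moreover have "z \<noteq> v" "z \<noteq> p" "z \<noteq> q" using small z by auto
    ultimately have "z \<notin> \<Union>?N" by simp
    then show "\<exists>x\<in>d. big x \<and> (inc D x = {d} \<and> x \<notin> \<Union>?N \<or> inc ?D x = {d})"
      using z by metis
  qed
  from optimal_card[OF opt this] show False
    using card_modify[OF DE, of ?R ?N] uD N cardN neE(1) by simp
qed


section \<open>Collisions under an optimal cover\<close>

definition crossing :: "'a set set \<Rightarrow> 'a set \<Rightarrow> 'a set \<Rightarrow> bool" where
  "crossing D e f \<longleftrightarrow> (\<exists>u v x y. e = {u, v} \<and> f = {x, y} \<and>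
     inc D u = {{u, x}} \<and> inc D x = {{u, x}} \<and> inc D v = {{v, y}} \<and> inc D y = {{v, y}})"

lemma crossing_sym: "crossing D e f \<Longrightarrow> crossing D f e"
proof -
  assume "crossing D e f"
  then obtain u v x y where *: "e = {u, v}" "f = {x, y}"
     "inc D u = {{u, x}}" "inc D x = {{u, x}}" "inc D v = {{v, y}}" "inc D y = {{v, y}}"
    unfolding crossing_def by (elim exE conjE)
  show "crossing D f e"
    unfolding crossing_def
    by (rule exI[of _ x], rule exI[of _ y], rule exI[of _ u], rule exI[of _ v])
      (use * in \<open>simp add: insert_commute\<close>)
qed

lemma nb_nonempty:
  assumes "optimal D" "e \<in> E"
  shows "nb D e \<noteq> {}"
proof -
  obtain f where f: "f \<in> E" "f \<noteq> e" "f \<inter> e \<noteq> {}"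
    using iso \<open>e \<in> E\<close> unfolding no_isolated_def by blast
  then obtain a where a: "a \<in> e" "a \<in> f" by blast
  then have "big a" using bigI[of e f a] f \<open>e \<in> E\<close> by auto
  then have "inc D a \<noteq> {}" using optimal_minimal_cover[OF assms(1)] by (simp add: minimal_cover_def)
  then obtain d where "d \<in> inc D a" by blast
  then have "d \<in> nb D e" using a by (auto simp: in_nb_iff in_inc_iff)
  then show ?thesis by blast
qed

text \<open>Equal traces of disjoint edges mean that every edge of \<open>D\<close> at one of the
  four ends joins \<open>{u, v}\<close> to \<open>{x, y}\<close>; given the edges at
  \<open>x\<close>, only \<open>{u, x}\<close>, \<open>{u, y}\<close> and \<open>{v, y}\<close> are
  possible. With \<open>{u, y}\<close> there is a closed star at \<open>u\<close> next to the
  uncovered \<open>v\<close>; with \<open>{u, x}\<close> alone both \<open>v\<close> and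
  \<open>y\<close> are uncovered. Both are excluded, so \<open>{u, x}\<close> and
  \<open>{v, y}\<close> remain.\<close>

lemma collision_crossing:
  assumes opt: "optimal D" and uv: "{u, v} \<in> E" "{u, v} \<notin> D" and xy: "{x, y} \<in> E" "{x, y} \<notin> D"
    and disj: "{u, v} \<inter> {x, y} = {}" and eq: "nb D {u, v} = nb D {x, y}"
    and x: "inc D x = {{u, x}}"
  shows "crossing D {u, v} {x, y}"
proof -
  have D: "minimal_cover D" using opt by (rule optimal_minimal_cover)
  have DE: "D \<subseteq> E" using D by (rule minimal_cover_subset)
  have grD: "simple_graph D" using simple_graph_subset[OF gr DE] .
  have ne: "u \<noteq> x" "u \<noteq> y" "v \<noteq> x" "v \<noteq> y" using disj by auto
  have "u \<noteq> v" "x \<noteq> y" using uv xy simple_graph_no_loop[OF gr] by metis+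
  have eq': "inc D u \<union> inc D v = insert {u, x} (inc D y)" using eq x by (simp add: nb_pair)
  have "{u, x} \<in> inc D x" by (simp add: x)
  then have uxD: "{u, x} \<in> D" by (simp add: in_inc_iff)
  have Du: "inc D u \<subseteq> {{u, x}, {u, y}}"
  proof
    fix d assume d: "d \<in> inc D u"
    then have "d = {u, x} \<or> d \<in> inc D y" using eq' by blast
    then show "d \<in> {{u, x}, {u, y}}" using d simple_graph_edge_eq[OF grD, of d u y] ne by (auto simp: in_inc_iff)
  qed
  have Dv: "inc D v \<subseteq> {{v, y}}"
  proof
    fix d assume d: "d \<in> inc D v"
    then have "d \<noteq> {u, x}" using \<open>u \<noteq> v\<close> ne by (auto simp: in_inc_iff)
    then have "d \<in> inc D y" using eq' d by blast
    then show "d \<in> {{v, y}}" using d simple_graph_edge_eq[OF grD, of d v y] ne by (auto simp: in_inc_iff)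
  qed
  have Dy: "inc D y \<subseteq> {{u, y}, {v, y}}"
  proof
    fix d assume d: "d \<in> inc D y"
    then have "d \<in> inc D u \<or> d \<in> inc D v" using eq' by blast
    moreover have "d \<noteq> {u, x}" using d ne \<open>x \<noteq> y\<close> by (auto simp: in_inc_iff)
    ultimately show "d \<in> {{u, y}, {v, y}}" using Du Dv by blast
  qed
  have ux_in: "{u, x} \<in> inc D u" using uxD by (simp add: in_inc_iff)
  show ?thesis
  proof (cases "{u, y} \<in> D")
    case True
    then have in_u: "{u, y} \<in> inc D u" and in_y: "{u, y} \<in> inc D y" by (simp_all add: in_inc_iff)
    have u: "inc D u = {{u, x}, {u, y}}" using Du in_u ux_in by blast
    obtain z where z: "z \<in> {u, y}" "inc D z = {{u, y}}" using minimal_cover_private[OF D True] by metis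
    have "z \<noteq> u"
    proof
      assume "z = u"
      then have "{u, x} \<in> {{u, y}}" using z(2) ux_in by simp
      then show False using \<open>x \<noteq> y\<close> by (simp add: doubleton_eq_iff)
    qed
    then have y: "inc D y = {{u, y}}" using z by auto
    have "{v, y} \<notin> inc D y" using y \<open>u \<noteq> v\<close> ne by (auto simp: doubleton_eq_iff)
    then have "{v, y} \<notin> D" by (auto simp: in_inc_iff)
    then have "inc D v = {}" using Dv by (auto simp: in_inc_iff)
    then show ?thesis
      using no_closed_star_pendant[OF opt \<open>x \<noteq> y\<close> u x y xy(1) uv(1)] by blast
  next
    case False
    then have "{u, y} \<notin> inc D u" by (simp add: in_inc_iff)
    then have u: "inc D u = {{u, x}}" using Du ux_in by blast
    have "{u, y} \<notin> inc D y" using False by (simp add: in_inc_iff)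
    then have Dy': "inc D y \<subseteq> {{v, y}}" using Dy by blast
    show ?thesis
    proof (cases "{v, y} \<in> D")
      case True
      then have "{v, y} \<in> inc D v" "{v, y} \<in> inc D y" by (simp_all add: in_inc_iff)
      then have "inc D v = {{v, y}}" "inc D y = {{v, y}}" using Dv Dy' by blast+
      then show ?thesis unfolding crossing_def using u x by metis
    next
      case False
      then have "{v, y} \<notin> inc D v" "{v, y} \<notin> inc D y" by (simp_all add: in_inc_iff)
      then have "inc D v = {}" "inc D y = {}" using Dv Dy' by blast+
      then show ?thesis using no_double_pendant[OF opt u x _ _ uv(1) xy(1)] by blast
    qed
  qed
qed

text \<open>If the edges share an end \<open>a\<close>, their far ends \<open>b\<close> and
  \<open>c\<close> have the same edges of \<open>D\<close>: either none, and both are pendant, or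
  just \<open>{b, c}\<close>, which then has the forbidden common neighbour \<open>a\<close>. If
  they are disjoint, an edge of \<open>D\<close> joins them, and its private end yields the
  hypothesis of \<open>collision_crossing\<close>, possibly with the roles exchanged.\<close>

lemma collision_cases:
  assumes opt: "optimal D" and e: "e \<in> E" "e \<notin> D" and f: "f \<in> E" "f \<notin> D" and "e \<noteq> f"
    and eq: "nb D e = nb D f"
  shows "exempt E e f \<or> e \<inter> f = {} \<and> crossing D e f"
proof (cases "e \<inter> f = {}")
  case False
  have D: "minimal_cover D" using opt by (rule optimal_minimal_cover)
  have DE: "D \<subseteq> E" using D by (rule minimal_cover_subset)
  have grD: "simple_graph D" using simple_graph_subset[OF gr DE] .
  obtain a where "a \<in> e" "a \<in> f" using False by blast
  then obtain b c where b: "e = {a, b}" "b \<noteq> a" and c: "f = {a, c}" "c \<noteq> a"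
    using simple_graph_edge_at[OF gr e(1)] simple_graph_edge_at[OF gr f(1)] by metis
  have "b \<noteq> c" using \<open>e \<noteq> f\<close> b c by auto
  have "d \<notin> inc D a" if "d \<in> inc D b" for d
    using that simple_graph_edge_eq[OF grD, of d a b] e(2) b by (auto simp: in_inc_iff)
  moreover have "d \<notin> inc D a" if "d \<in> inc D c" for d
    using that simple_graph_edge_eq[OF grD, of d a c] f(2) c by (auto simp: in_inc_iff)
  moreover have "inc D a \<union> inc D b = inc D a \<union> inc D c" using eq b c by (simp add: nb_pair)
  ultimately have bc: "inc D b = inc D c" by blast
  show ?thesis
  proof (cases "inc D b = {}")
    case True
    then have "inc E b = {e}" "inc E c = {f}"
      using uncovered[OF D True e(1)] uncovered[OF D _ f(1), of c] bc b c by auto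
    then show ?thesis using exempt_leafI[OF \<open>b \<noteq> c\<close> b(1) c(1)] b c by simp
  next
    case False
    then obtain d where "d \<in> inc D b" "d \<in> inc D c" using bc by blast
    then have "{b, c} \<in> D" using inc_common(2)[OF grD _ _ \<open>b \<noteq> c\<close>] by metis
    then have "inc D b = {{b, c}}" using inc_only[OF grD bc] by simp
    then show ?thesis
      using no_common_neighbour[OF opt \<open>b \<noteq> c\<close>, of a] bc e f b c by simp
  qed
next
  case disj: True
  have D: "minimal_cover D" using opt by (rule optimal_minimal_cover)
  have grD: "simple_graph D" using simple_graph_subset[OF gr minimal_cover_subset[OF D]] .
  obtain d where d: "d \<in> nb D e" using nb_nonempty[OF opt e(1)] by blast
  then have "d \<in> nb D f" using eq by simp
  then obtain p q where p: "p \<in> d" "p \<in> e" and q: "q \<in> d" "q \<in> f" and "d \<in> D"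
    using d by (auto simp: in_nb_iff)
  have "p \<noteq> q" using p q disj by blast
  then have d': "d = {p, q}" using simple_graph_edge_eq[OF grD \<open>d \<in> D\<close>] p q by metis
  obtain p' where p': "e = {p, p'}" using simple_graph_edge_at[OF gr e(1) p(2)] by metis
  obtain q' where q': "f = {q, q'}" using simple_graph_edge_at[OF gr f(1) q(2)] by metis
  obtain z where "z \<in> d" "inc D z = {d}" using minimal_cover_private[OF D \<open>d \<in> D\<close>] by metis
  then consider "inc D p = {{q, p}}" | "inc D q = {{p, q}}" using d' by (auto simp: insert_commute)
  then show ?thesis
  proof cases
    case 1
    have "crossing D {q, q'} {p, p'}"
      by (rule collision_crossing[OF opt _ _ _ _ _ _ 1]) (use e f p' q' disj eq in auto)
    then show ?thesis using crossing_sym p' q' disj by metis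
  next
    case 2
    have "crossing D {p, p'} {q, q'}"
      by (rule collision_crossing[OF opt _ _ _ _ _ _ 2]) (use e f p' q' disj eq in auto)
    then show ?thesis using p' q' disj by metis
  qed
qed

lemma half_no_deg2: "half_bound E"
proof -
  obtain D where opt: "optimal D" using ex_optimal by blast
  have D: "minimal_cover D" using opt by (rule optimal_minimal_cover)
  have DE: "D \<subseteq> E" using D by (rule minimal_cover_subset)
  have finD: "finite D" using DE finite_E finite_subset by blast
  define P where "P = both_private D"
  have finP: "finite P" using finD by (auto simp: P_def both_private_def)
  \<comment> \<open>A matching on the members of \<open>P\<close>, realised by edges outside
    \<open>D\<close>. Disjointness gives 2 |A| \<le> |P|, exactly the surplus left by the
    count.\<close>
  define join where "join A \<longleftrightarrow> A \<subseteq> E - D \<and> (\<forall>a\<in>A. 2 \<le> card {d \<in> P. d \<inter> a \<noteq> {}}) \<and>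
    (\<forall>a\<in>A. \<forall>b\<in>A. a \<noteq> b \<longrightarrow> {d \<in> P. d \<inter> a \<noteq> {}} \<inter> {d \<in> P. d \<inter> b \<noteq> {}} = {})" for A
  have "join {}" by (simp add: join_def)
  moreover have "card A \<le> card E" if "join A" for A
    using that card_mono[OF finite_E, of A] by (auto simp: join_def)
  ultimately have "\<exists>A. join A \<and> (\<forall>B. join B \<longrightarrow> card B \<le> card A)"
    by (intro ex_has_greatest_nat[of join "{}" card "Suc (card E)"]) (auto simp: less_Suc_eq_le)
  then obtain A where A: "join A" and max: "\<And>B. join B \<Longrightarrow> card B \<le> card A"
    by metis
  have AE: "A \<subseteq> E - D" using A by (simp add: join_def)
  have finA: "finite A" using AE finite_E finite_subset by blast
  have "2 * card A \<le> (\<Sum>a\<in>A. card {d \<in> P. d \<inter> a \<noteq> {}})"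
    using sum_bounded_below[of A 2 "\<lambda>a. card {d \<in> P. d \<inter> a \<noteq> {}}"] A by (simp add: join_def)
  also have "\<dots> = card (\<Union>a\<in>A. {d \<in> P. d \<inter> a \<noteq> {}})"
    by (rule card_UN_disjoint[symmetric]) (use finA finP A in \<open>auto simp: join_def\<close>)
  also have "\<dots> \<le> card P" using finP by (intro card_mono) auto
  finally have cardA: "2 * card A \<le> card P" .
  have "card (D \<union> A) \<le> card D + card A" by (rule card_Un_le)
  then have "2 * card (D \<union> A) \<le> card E"
    using card_minimal_cover[OF D] cardA unfolding P_def by linarith
  moreover have "good E (D \<union> A)"
    unfolding good_def
  proof (intro conjI ballI impI)
    show "D \<union> A \<subseteq> E" using DE AE by auto
  next
    fix e assume "e \<in> E - (D \<union> A)"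
    then show "nb (D \<union> A) e \<noteq> {}" using nb_nonempty[OF opt, of e] by (simp add: nb_Un)
  next
    fix e f assume e: "e \<in> E - (D \<union> A)" and f: "f \<in> E - (D \<union> A)" and "e \<noteq> f"
      and eq: "nb (D \<union> A) e = nb (D \<union> A) f"
    have "nb D e = nb D f"
    proof -
      have "nb D g = nb (D \<union> A) g \<inter> D" for g by (auto simp: in_nb_iff)
      then show ?thesis using eq by metis
    qed
    then have "exempt E e f \<or> e \<inter> f = {} \<and> crossing D e f"
      using collision_cases[OF opt _ _ _ _ \<open>e \<noteq> f\<close>] e f by simp
    then show "exempt E e f"
    proof
      assume "e \<inter> f = {} \<and> crossing D e f"
      then have disj: "e \<inter> f = {}" and "crossing D e f" by simp_all
      then obtain u v x y where uv: "e = {u, v}" and xy: "f = {x, y}"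
        and u: "inc D u = {{u, x}}" and x: "inc D x = {{u, x}}"
        and v: "inc D v = {{v, y}}" and y: "inc D y = {{v, y}}"
        unfolding crossing_def by (elim exE conjE)
      have ne: "u \<noteq> x" "u \<noteq> y" "v \<noteq> x" "v \<noteq> y" using disj uv xy by auto
      have uvE: "{u, v} \<in> E" "{x, y} \<in> E" using e f uv xy by auto
      then have "u \<noteq> v" "x \<noteq> y" using simple_graph_no_loop[OF gr] by metis+
      have "{u, x} \<in> inc D u" "{v, y} \<in> inc D v" by (simp_all add: u v)
      then have dD: "{u, x} \<in> D" "{v, y} \<in> D" by (simp_all add: in_inc_iff)
      have "big u" "big v" "big x" "big y"
        using bigI[of "{u, x}" "{u, v}" u] bigI[of "{v, y}" "{u, v}" v]
          bigI[of "{u, x}" "{x, y}" x] bigI[of "{v, y}" "{x, y}" y] dD DE uvE ne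
        by (auto simp: doubleton_eq_iff)
      then have dP: "{u, x} \<in> P" "{v, y} \<in> P"
        using dD u v x y by (auto simp: P_def both_private_def)
      have dne: "{u, x} \<noteq> {v, y}" using \<open>u \<noteq> v\<close> ne by (auto simp: doubleton_eq_iff)
      have De: "d = {u, x} \<or> d = {v, y}" if "d \<in> D" "d \<inter> e \<noteq> {}" for d
        using that incD[OF u, of d] incD[OF v, of d] uv by auto
      \<comment> \<open>The edge \<open>e\<close> could join \<open>{u, x}\<close> to
        \<open>{v, y}\<close>, so by maximality some \<open>a\<close> in \<open>A\<close> already
        touches one of them and hence meets \<open>e\<close> or \<open>f\<close>. Equal traces force
        it to meet both, so \<open>a\<close> is a diagonal of the 4-cycle and gives an isolated edge
        of \<open>D\<close> a common neighbour of its ends.\<close>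
      have "\<not> join (insert e A)"
      proof
        assume "join (insert e A)"
        then have "card (insert e A) \<le> card A" by (rule max)
        then show False using e finA by simp
      qed
      moreover have "insert e A \<subseteq> E - D" using AE e by auto
      moreover have "2 \<le> card {d \<in> P. d \<inter> e \<noteq> {}}"
      proof -
        have "{{u, x}, {v, y}} \<subseteq> {d \<in> P. d \<inter> e \<noteq> {}}" using dP uv by auto
        then have "card {{u, x}, {v, y}} \<le> card {d \<in> P. d \<inter> e \<noteq> {}}"
          using finP by (intro card_mono) auto
        then show ?thesis using dne by simp
      qed
      moreover have "\<forall>a\<in>A. 2 \<le> card {d \<in> P. d \<inter> a \<noteq> {}}" using A by (simp add: join_def)
      ultimately have "\<not> (\<forall>a\<in>insert e A. \<forall>b\<in>insert e A. a \<noteq> b \<longrightarrow>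
          {d \<in> P. d \<inter> a \<noteq> {}} \<inter> {d \<in> P. d \<inter> b \<noteq> {}} = {})"
        unfolding join_def by simp
      then obtain a b where ab: "a \<in> insert e A" "b \<in> insert e A" "a \<noteq> b"
        "{d \<in> P. d \<inter> a \<noteq> {}} \<inter> {d \<in> P. d \<inter> b \<noteq> {}} \<noteq> {}" by blast
      have "a = e \<or> b = e" using ab A unfolding join_def by blast
      then obtain a d where a: "a \<in> A" and d: "d \<in> P" "d \<inter> a \<noteq> {}" "d \<inter> e \<noteq> {}"
        using ab by blast
      have "d \<in> D" using d by (simp add: P_def both_private_def)
      then have "d = {u, x} \<or> d = {v, y}" using De d by blast
      then have "a \<inter> e \<noteq> {} \<or> a \<inter> f \<noteq> {}" using d(2) uv xy by auto
      moreover have "a \<inter> e \<noteq> {} \<longleftrightarrow> a \<inter> f \<noteq> {}" using nb_eq_meets[OF eq, of a] a by simp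
      ultimately obtain p q where p: "p \<in> a" "p \<in> e" and q: "q \<in> a" "q \<in> f" by blast
      have "p \<noteq> q" using p q disj by blast
      have aE: "a \<in> E" "a \<notin> D" using AE a by auto
      then have a': "a = {p, q}" using simple_graph_edge_eq[OF gr _ p(1) q(1) \<open>p \<noteq> q\<close>] by simp
      have "a \<noteq> {u, x}" "a \<noteq> {v, y}" using aE dD by auto
      then have "a = {u, y} \<or> a = {v, x}" using a' p(2) q(2) uv xy by auto
      then show "exempt E e f"
      proof
        assume "a = {u, y}"
        then show ?thesis
          using no_common_neighbour[OF opt ne(4) v y uvE(1)] aE by simp
      next
        assume "a = {v, x}"
        moreover have "{v, u} \<in> E" using uvE by (simp add: insert_commute)
        ultimately show ?thesis
          using no_common_neighbour[OF opt ne(1) u x, of v] aE by simp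
      qed
    qed
  qed
  ultimately show ?thesis unfolding half_bound_def by blast
qed

end

section \<open>The induction, and the translation into edge-twins\<close>

lemma half_no_isolated:
  assumes "simple_graph E" "no_isolated E"
  shows "half_bound E"
proof -
  have "finite E" using assms by (simp add: simple_graph_def)
  then show ?thesis using assms
  proof (induction E rule: finite_psubset_induct)
    case (psubset E)
    have IH: "half_bound E'" if "E' \<subset> E" "no_isolated E'" for E'
      using psubset.IH[OF that(1) _ that(2)] simple_graph_subset[OF psubset.prems(1)] that by blast
    show ?case
    proof (cases "\<exists>w. card (inc E w) = 2")
      case False
      then interpret no_deg2 E using psubset.prems by unfold_locales auto
      show ?thesis by (rule half_no_deg2)
    next
      case True
      then obtain w e f where ef: "inc E w = {e, f}" "e \<noteq> f" by (auto simp: card_2_iff)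
      then have "e \<in> inc E w" "f \<in> inc E w" by simp_all
      then have "e \<in> E" "w \<in> e" "f \<in> E" "w \<in> f" by (simp_all add: in_inc_iff)
      then obtain u v where "e = {w, u}" "f = {w, v}" using simple_graph_edge_at[OF psubset.prems(1)] by metis
      then have w: "inc E w = {{w, u}, {w, v}}" "u \<noteq> v" using ef by auto
      consider "\<not> pendant_path_free E" | "\<not> deg2_triangle_free E"
        | "pendant_path_free E" "deg2_triangle_free E" by argo
      then show ?thesis
      proof cases
        case 1
        then show ?thesis using half_pendant_path[OF psubset.prems IH] by simp
      next
        case 2
        then show ?thesis using half_triangle[OF psubset.prems IH] by simp
      next
        case 3
        show ?thesis by (rule half_deg2[OF psubset.prems 3 IH w])
      qed
    qed
  qed
qed

lemma nb_eq_open_edge_nbhd: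
  assumes "D \<subseteq> E" "e \<notin> D"
  shows "open_edge_nbhd E e \<inter> D = nb D e"
  using assms by (auto simp: open_edge_nbhd_def share_end_def nb_def)

lemma open_edge_nbhd_pair:
  "open_edge_nbhd E {u, v} = inc E u \<union> inc E v - {{u, v}}"
  by (rule set_eqI) (simp add: open_edge_nbhd_def share_end_def inc_def, argo)

text \<open>Leaf and triangle pairs have equal closed neighbourhoods, since beyond the edges at
  \<open>s\<close> there is at most the shared edge \<open>{a, b}\<close>. The end edges of the path
  both have the middle edge as their only neighbour.\<close>

lemma exempt_edge_twins:
  assumes "e \<in> E" "f \<in> E" "e \<noteq> f" "exempt E e f"
  shows "edge_twins E e f"
  using assms(4)
proof (cases rule: exempt_cases)
  case (leaf s a b)
  have "{s, a} \<in> inc E s" "{s, b} \<in> inc E s" using assms leaf by (simp_all add: in_inc_iff)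
  then have "closed_edge_nbhd E e = closed_edge_nbhd E f"
    unfolding closed_edge_nbhd_def leaf open_edge_nbhd_pair by (auto simp: leaf(4,5))
  then show ?thesis using assms by (simp add: edge_twins_def)
next
  case (triangle s a b)
  have "{s, a} \<in> inc E s" "{s, b} \<in> inc E s" using assms triangle by (simp_all add: in_inc_iff)
  then have "closed_edge_nbhd E e = closed_edge_nbhd E f"
    unfolding closed_edge_nbhd_def triangle(2,3) open_edge_nbhd_pair by (auto simp: triangle(4,5))
  then show ?thesis using assms by (simp add: edge_twins_def)
next
  case (path a b c d)
  have "{a, b} \<noteq> {b, c}" "{c, d} \<noteq> {b, c}" using path(1) by (auto simp: doubleton_eq_iff)
  then have "open_edge_nbhd E e = open_edge_nbhd E f"
    unfolding path(2,3) open_edge_nbhd_pair by (auto simp: path(4-7))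
  then show ?thesis using assms by (simp add: edge_twins_def)
qed

lemma good_weak_eld:
  assumes "good E D"
  shows "weak_edge_locating_dominating_set E D"
proof -
  have D: "D \<subseteq> E" using assms by (rule good_subset)
  have "\<exists>d\<in>D. share_end e d" if e: "e \<in> E - D" for e
  proof -
    have "nb D e \<noteq> {}" using good_nb[OF assms] e by simp
    then show ?thesis by (auto simp: nb_def share_end_def)
  qed
  moreover have "edge_twins E e f" if e: "e \<in> E - D" and f: "f \<in> E - D" and "e \<noteq> f"
    and eq: "open_edge_nbhd E e \<inter> D = open_edge_nbhd E f \<inter> D" for e f
  proof -
    have "nb D e = nb D f" using eq nb_eq_open_edge_nbhd[OF D] e f by simp
    then show ?thesis
      using good_exempt[OF assms, of e f] exempt_edge_twins e f \<open>e \<noteq> f\<close> by blast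
  qed
  ultimately show ?thesis
    using D unfolding weak_edge_locating_dominating_set_def edge_dominating_set_def by blast
qed

theorem theorem1:
  fixes V :: "'a set" and E :: "'a set set" and m :: nat
  assumes "finite_simple_graph V E"
    and "card E = m"
    and "\<not> (\<exists>e\<in>E. isolated_edge E e)"
  shows "\<exists>D. weak_edge_locating_dominating_set E D \<and> real (card D) \<le> real m / 2"
proof -
  have V: "finite V" "E \<subseteq> nsets V 2" using assms(1) by (auto simp: finite_simple_graph_def)
  have "E \<subseteq> Pow V" using V(2) by (auto simp: nsets_def)
  then have "finite E" using V(1) finite_subset by blast
  then have gr: "simple_graph E" using V(2) by (auto simp: simple_graph_def nsets_def)
  have "no_isolated E"
    unfolding no_isolated_def
  proof
    fix e assume e: "e \<in> E"
    then obtain v where v: "v \<in> e" "card (inc E v) \<noteq> 1"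
      using assms(3) unfolding isolated_edge_def degree_def inc_def by blast
    have "inc E v \<noteq> {e}" using v by auto
    moreover have "e \<in> inc E v" using e v by (simp add: in_inc_iff)
    ultimately obtain f where "f \<in> inc E v" "f \<noteq> e" by blast
    then show "\<exists>f\<in>E. f \<noteq> e \<and> f \<inter> e \<noteq> {}" using v by (auto simp: in_inc_iff)
  qed
  then have "half_bound E" using half_no_isolated gr by blast
  then obtain D where "good E D" "2 * card D \<le> m" using assms(2) unfolding half_bound_def by blast
  then show ?thesis using good_weak_eld by (intro exI[of _ D]) auto
qed

end
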